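(* Let $\Bbbk$ be a field and $(A,\Delta)$ a cocommutative $\Bbbk$-algebra with a nilpotent maximal (two-sided) ideal $\mathfrak{m}\ne0$ such that $A=\mathfrak{m}\oplus\Bbbk\cdot1_A$ and $\Delta(\mathfrak{m})\subset\mathfrak{m}\otimes\mathfrak{m}$. Let $V$ be an $A$-module, and let $\lambda:A\otimes V\to A$ and $\kappa=\kappa_V\oplus\kappa_A:V\wedge V\to V\oplus A$ be $\Bbbk$-linear maps, with deformed smash product algebra $\mathscr{H}_{\lambda,\kappa}$. If $\lambda$ satisfies $$\lambda(aa',v)=a\,\lambda(a',v)+\sum\lambda(a,a'_{(1)}(v))\,a'_{(2)}\quad\text{in }A,\qquad\forall a,a'\in A,\ v\in V,$$ then $\lambda(\mathfrak{m}^k,\mathscr{L}_{\le k}(V))\subset\mathfrak{m}^k$ for all $k\ge0$. If instead we assume $\kappa_V\equiv0$, then the following are equivalent for $\mathscr{H}_{\lambda,\kappa}$: (1) $\lambda(\mathfrak{m}^k,V)\subset\mathfrak{m}^k$ for all $k\ge0$, and $\kappa_A:V\wedge V\to\mathfrak{m}$ (i.e. $\operatorname{im}\kappa_A\subset\mathfrak{m}$). (2) $\lambda(\mathfrak{m},V)\subset\mathfrak{m}$ and $\kappa_A:V\wedge V\to\mathfrak{m}$. (3) There exists a one-dimensional $\mathscr{H}_{\lambda,\kappa}$-module killed by $\mathfrak{m}$. (4) There is a bijection from simple $\mathscr{H}_{\lambda,\kappa}$-modules to simple $\mathrm{Sym}(V)$-modules, determined uniquely by restriction from $\mathscr{H}_{\lambda,\kappa}$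 to the image of $V$; moreover, the inverse map is given by restriction to $V$ and inflation to $\mathscr{H}_{\lambda,\kappa}$, letting $\mathfrak{m}$ act trivially.
   Context: A cocommutative $\Bbbk$-algebra $(A,\Delta)$ is a unital associative $\Bbbk$-algebra $A$ with a $\Bbbk$-algebra map $\Delta:A\to A\otimes A$ satisfying $\Delta(1)=1\otimes1$, coassociativity, and $\Delta=\Delta^{op}$ (no counit or antipode is assumed). Sweedler notation: $\Delta(a)=\sum a_{(1)}\otimes a_{(2)}$. The action of $a\in A$ on $v\in V$ is written $a(v)$. $\mathfrak{m}^0=A$. For an $A$-module $M$, the level of a nonzero $m\in M$ is the integer $k>0$ with $\mathfrak{m}^km=0\ne\mathfrak{m}^{k-1}m$; the level of $0$ is $0$. $\mathscr{L}_{\le k}(M)$ is the set of elements of level at most $k$ (equivalently $\{m:\mathfrak{m}^km=0\}$). $V\wedge V\subset V\otimes V$ is the span of the $v\wedge v'=v\otimes v'-v'\otimes v$; $\kappa(v,v')=\kappa(v\wedge v')$, and $\kappa_V,\kappa_A$ are the projections of $\kappa$ to $V$ and $A$. $\mathscr{H}_{\lambda,\kappa}$ is the quotient of the tensor algebra $T(V\oplus A)$ by the multiplication in $A$ (with $1_A$ the unit) and by the relations $av-\sum a_{(1)}(v)a_{(2)}=\lambda(a,v)$ and $vv'-v'v=\kappa(v,v')$ for $a\in A$, $v,v'\in V$.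
   Formalization: The four-way equivalence keeps the displayed identity for λ besides κ_V≡0, as (2)⇒(1) and (2)⇒(3) fail without it; without the identity only (1)⇒(2), (3)⇒(2), (3)⇔(4), and (2)⇒(3) when λ(1,V)⊂𝔪 are asserted. *)

theory Defs
  imports
    "HOL-Algebra.Algebraic_Closure_Type"
    "HOL-Algebra.Ideal_Product"
    "HOL-Algebra.Module"
    "HOL-Library.Poly_Mapping"
    "HOL-Library.Product_Plus"
begin

locale k_algebra = vector_space s
  for s :: "'k::field \<Rightarrow> 'a::ring_1 \<Rightarrow> 'a" +
  assumes scale_mult_left: "s c (x * y) = s c x * y"
    and scale_mult_right: "s c (x * y) = x * s c y"

definition bilinear_map ::
  "('k::field \<Rightarrow> 'a::ab_group_add \<Rightarrow> 'a) \<Rightarrow> ('k \<Rightarrow> 'b::ab_group_add \<Rightarrow> 'b)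
    \<Rightarrow> ('k \<Rightarrow> 'c::ab_group_add \<Rightarrow> 'c) \<Rightarrow> ('a \<Rightarrow> 'b \<Rightarrow> 'c) \<Rightarrow> bool"
  where "bilinear_map s1 s2 s3 f \<longleftrightarrow>
    (\<forall>x. Vector_Spaces.linear s2 s3 (f x)) \<and> (\<forall>y. Vector_Spaces.linear s1 s3 (\<lambda>x. f x y))"

locale algebra_module = A: k_algebra sA + V: vector_space sV
  for sA :: "'k::field \<Rightarrow> 'a::ring_1 \<Rightarrow> 'a"
    and sV :: "'k \<Rightarrow> 'v::ab_group_add \<Rightarrow> 'v" +
  fixes act :: "'a \<Rightarrow> 'v \<Rightarrow> 'v"
  assumes act_bilinear: "bilinear_map sA sV sV act"
    and act_mult: "act (a * b) v = act a (act b v)"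
    and act_one: "act 1 v = v"

definition scale_prod ::
  "('k \<Rightarrow> 'v \<Rightarrow> 'v) \<Rightarrow> ('k \<Rightarrow> 'a \<Rightarrow> 'a) \<Rightarrow> 'k \<Rightarrow> 'v \<times> 'a \<Rightarrow> 'v \<times> 'a"
  where "scale_prod sV sA c p = (sV c (fst p), sA c (snd p))"

text \<open>The unit of the monoid \<open>ideals_set\<close> is the carrier, so \<open>ideal_power I 0\<close> is the whole ring.\<close>

definition ideal_power :: "'a::ring_1 set \<Rightarrow> nat \<Rightarrow> 'a set"
  where "ideal_power I k = I [^]\<^bsub>ideals_set ring_of_type_algebra\<^esub> k"

definition has_level :: "('a::ring_1 \<Rightarrow> 'v::ab_group_add \<Rightarrow> 'v) \<Rightarrow> 'a set \<Rightarrow> 'v \<Rightarrow> nat \<Rightarrow> bool"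
  where "has_level act I v k \<longleftrightarrow>
    (if v = 0 then k = 0
     else k > 0 \<and> (\<forall>a\<in>ideal_power I k. act a v = 0) \<and> (\<exists>a\<in>ideal_power I (k - 1). act a v \<noteq> 0))"

definition level_le :: "('a::ring_1 \<Rightarrow> 'v::ab_group_add \<Rightarrow> 'v) \<Rightarrow> 'a set \<Rightarrow> nat \<Rightarrow> 'v set"
  where "level_le act I k = {v. \<exists>j\<le>k. has_level act I v j}"

text \<open>
  With concatenation as addition of lists, the library multiplication on \<open>'w list \<Rightarrow>\<^sub>0 'k\<close> makes
  this type the free associative unital algebra on the set \<open>'w\<close>: the word \<open>w\<^sub>1\<dots>w\<^sub>n\<close> is
  \<open>Poly_Mapping.single [w\<^sub>1,\<dots>,w\<^sub>n] 1\<close>.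
\<close>

instantiation list :: (type) monoid_add
begin
definition zero_list :: "'a list" where "zero_list = []"
definition plus_list :: "'a list \<Rightarrow> 'a list \<Rightarrow> 'a list" where "plus_list xs ys = xs @ ys"
instance by standard (auto simp: zero_list_def plus_list_def)
end

type_synonym ('k, 'w) tensor = "('w list \<Rightarrow>\<^sub>0 'k) set"

text \<open>
  The tensor algebra \<open>T(W)\<close> is the free algebra on the set \<open>W\<close> modulo linearity of the map sending
  \<open>w\<close> to the letter \<open>w\<close>.  In word length \<open>n\<close> this ideal consists of the multilinearity relations, so
  the image of the words of length \<open>n\<close> spans the \<open>n\<close>-fold tensor power of \<open>W\<close>.
\<close>

definition linearity_ideal ::
  "('k::field \<Rightarrow> 'w::ab_group_add \<Rightarrow> 'w) \<Rightarrow> ('w list \<Rightarrow>\<^sub>0 'k) set"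
  where "linearity_ideal s = Idl\<^bsub>ring_of_type_algebra\<^esub>
    ({Poly_Mapping.single [x + y] 1 - Poly_Mapping.single [x] 1 - Poly_Mapping.single [y] 1 | x y. True}
     \<union> {Poly_Mapping.single [s c x] 1 - Poly_Mapping.single [x] c | c x. True})"

definition tensor_algebra ::
  "('k::field \<Rightarrow> 'w::ab_group_add \<Rightarrow> 'w) \<Rightarrow> ('k, 'w) tensor ring"
  where "tensor_algebra s = ring_of_type_algebra Quot linearity_ideal s"

definition tvec :: "('k::field \<Rightarrow> 'w::ab_group_add \<Rightarrow> 'w) \<Rightarrow> 'w \<Rightarrow> ('k, 'w) tensor"
  where "tvec s w = linearity_ideal s +>\<^bsub>ring_of_type_algebra\<^esub> Poly_Mapping.single [w] 1"

definition tscalar :: "('k::field \<Rightarrow> 'w::ab_group_add \<Rightarrow> 'w) \<Rightarrow> 'k \<Rightarrow> ('k, 'w) tensor"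
  where "tscalar s c = linearity_ideal s +>\<^bsub>ring_of_type_algebra\<^esub> Poly_Mapping.single [] c"

definition list_sum :: "('r, 'b) ring_scheme \<Rightarrow> 'r list \<Rightarrow> 'r"
  where "list_sum R xs = foldr (\<lambda>x y. x \<oplus>\<^bsub>R\<^esub> y) xs \<zero>\<^bsub>R\<^esub>"

text \<open>
  \<open>W \<otimes> W\<close> is used as the degree-two part of \<open>T(W)\<close>; \<open>tensor2 s [(x\<^sub>1,y\<^sub>1),\<dots>]\<close> is
  \<open>x\<^sub>1 \<otimes> y\<^sub>1 + \<dots>\<close>, and every element of \<open>W \<otimes> W\<close> is of this form.
\<close>

definition tensor2 :: "('k::field \<Rightarrow> 'w::ab_group_add \<Rightarrow> 'w) \<Rightarrow> ('w \<times> 'w) list \<Rightarrow> ('k, 'w) tensor"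
  where "tensor2 s ps =
    list_sum (tensor_algebra s) (map (\<lambda>(x, y). tvec s x \<otimes>\<^bsub>tensor_algebra s\<^esub> tvec s y) ps)"

text \<open>
  A list \<open>ps\<close> of pairs with \<open>\<Delta> a = tensor2 s ps\<close> is a Sweedler presentation of \<open>\<Delta> a\<close>.  Formulas in
  Sweedler notation are stated for all presentations; they do not depend on the choice.  In
  \<open>cop_coassoc\<close>, the two sides \<open>\<Sum> \<Delta>(a\<^sub>1) \<otimes> a\<^sub>2\<close> and \<open>\<Sum> a\<^sub>1 \<otimes> \<Delta>(a\<^sub>2)\<close> are formed in the degree-three
  part of the tensor algebra of \<open>A\<close>.
\<close>

locale cocommutative_algebra = k_algebra s
  for s :: "'k::field \<Rightarrow> 'a::ring_1 \<Rightarrow> 'a" +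
  fixes \<Delta> :: "'a \<Rightarrow> ('k, 'a) tensor"
  assumes cop_tensor: "\<exists>ps. \<Delta> a = tensor2 s ps"
    and cop_add: "\<Delta> (a + b) = \<Delta> a \<oplus>\<^bsub>tensor_algebra s\<^esub> \<Delta> b"
    and cop_scale: "\<Delta> (s c a) = tscalar s c \<otimes>\<^bsub>tensor_algebra s\<^esub> \<Delta> a"
    and cop_one: "\<Delta> 1 = tensor2 s [(1, 1)]"
    and cop_mult: "\<lbrakk>\<Delta> a = tensor2 s ps; \<Delta> b = tensor2 s qs\<rbrakk> \<Longrightarrow>
      \<Delta> (a * b) = tensor2 s [(x * x', y * y'). (x, y) \<leftarrow> ps, (x', y') \<leftarrow> qs]"
    and cop_coassoc: "\<Delta> a = tensor2 s ps \<Longrightarrow>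
      list_sum (tensor_algebra s) (map (\<lambda>(x, y). \<Delta> x \<otimes>\<^bsub>tensor_algebra s\<^esub> tvec s y) ps) =
      list_sum (tensor_algebra s) (map (\<lambda>(x, y). tvec s x \<otimes>\<^bsub>tensor_algebra s\<^esub> \<Delta> y) ps)"
    and cop_cocomm: "\<Delta> a = tensor2 s ps \<Longrightarrow> \<Delta> a = tensor2 s (map (\<lambda>(x, y). (y, x)) ps)"

type_synonym ('k, 'v, 'a) smash = "('k, 'v \<times> 'a) tensor set"
type_synonym ('k, 'v) sym = "('k, 'v) tensor set"

text \<open>
  The linear maps \<open>\<lambda>\<close> on \<open>A \<otimes> V\<close> and \<open>\<kappa>\<close> on \<open>V \<and> V\<close> enter as the bilinear map \<open>lam a v\<close> and as
  the alternating bilinear map \<open>kap v w = \<kappa>(v \<and> w)\<close> with values in \<open>V \<oplus> A\<close>.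
\<close>

definition smash_relations ::
  "('k::field \<Rightarrow> 'a::ring_1 \<Rightarrow> 'a) \<Rightarrow> ('a \<Rightarrow> ('k, 'a) tensor) \<Rightarrow> ('k \<Rightarrow> 'v::ab_group_add \<Rightarrow> 'v)
    \<Rightarrow> ('a \<Rightarrow> 'v \<Rightarrow> 'v) \<Rightarrow> ('a \<Rightarrow> 'v \<Rightarrow> 'a) \<Rightarrow> ('v \<Rightarrow> 'v \<Rightarrow> 'v \<times> 'a) \<Rightarrow> ('k, 'v \<times> 'a) tensor set"
  where "smash_relations sA \<Delta> sV act lam kap =
    (let T = tensor_algebra (scale_prod sV sA);
         iV = (\<lambda>v. tvec (scale_prod sV sA) (v, 0));
         iA = (\<lambda>a. tvec (scale_prod sV sA) (0, a))
     in {iA a \<otimes>\<^bsub>T\<^esub> iA b \<ominus>\<^bsub>T\<^esub> iA (a * b) | a b. True}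
      \<union> {iA 1 \<ominus>\<^bsub>T\<^esub> \<one>\<^bsub>T\<^esub>}
      \<union> {iA a \<otimes>\<^bsub>T\<^esub> iV v \<ominus>\<^bsub>T\<^esub> list_sum T (map (\<lambda>(x, y). iV (act x v) \<otimes>\<^bsub>T\<^esub> iA y) ps)
            \<ominus>\<^bsub>T\<^esub> iA (lam a v) | a v ps. \<Delta> a = tensor2 sA ps}
      \<union> {iV v \<otimes>\<^bsub>T\<^esub> iV w \<ominus>\<^bsub>T\<^esub> iV w \<otimes>\<^bsub>T\<^esub> iV v
            \<ominus>\<^bsub>T\<^esub> tvec (scale_prod sV sA) (kap v w) | v w. True})"

locale smash_data =
  fixes sA :: "'k::field \<Rightarrow> 'a::ring_1 \<Rightarrow> 'a"
    and \<Delta> :: "'a \<Rightarrow> ('k, 'a) tensor"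
    and sV :: "'k \<Rightarrow> 'v::ab_group_add \<Rightarrow> 'v"
    and act :: "'a \<Rightarrow> 'v \<Rightarrow> 'v"
    and lam :: "'a \<Rightarrow> 'v \<Rightarrow> 'a"
    and kap :: "'v \<Rightarrow> 'v \<Rightarrow> 'v \<times> 'a"
begin

definition smash_ideal :: "('k, 'v \<times> 'a) tensor set"
  where "smash_ideal =
    Idl\<^bsub>tensor_algebra (scale_prod sV sA)\<^esub> (smash_relations sA \<Delta> sV act lam kap)"

definition smash_algebra :: "('k, 'v, 'a) smash ring"
  where "smash_algebra = tensor_algebra (scale_prod sV sA) Quot smash_ideal"

definition smash_V :: "'v \<Rightarrow> ('k, 'v, 'a) smash"
  where "smash_V v = smash_ideal +>\<^bsub>tensor_algebra (scale_prod sV sA)\<^esub> tvec (scale_prod sV sA) (v, 0)"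

definition smash_A :: "'a \<Rightarrow> ('k, 'v, 'a) smash"
  where "smash_A a = smash_ideal +>\<^bsub>tensor_algebra (scale_prod sV sA)\<^esub> tvec (scale_prod sV sA) (0, a)"

definition smash_scalar :: "'k \<Rightarrow> ('k, 'v, 'a) smash"
  where "smash_scalar c = smash_ideal +>\<^bsub>tensor_algebra (scale_prod sV sA)\<^esub> tscalar (scale_prod sV sA) c"

end

definition sym_ideal :: "('k::field \<Rightarrow> 'v::ab_group_add \<Rightarrow> 'v) \<Rightarrow> ('k, 'v) tensor set"
  where "sym_ideal sV = Idl\<^bsub>tensor_algebra sV\<^esub>
    {tvec sV v \<otimes>\<^bsub>tensor_algebra sV\<^esub> tvec sV w
       \<ominus>\<^bsub>tensor_algebra sV\<^esub> tvec sV w \<otimes>\<^bsub>tensor_algebra sV\<^esub> tvec sV v | v w. True}"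

definition sym_algebra :: "('k::field \<Rightarrow> 'v::ab_group_add \<Rightarrow> 'v) \<Rightarrow> ('k, 'v) sym ring"
  where "sym_algebra sV = tensor_algebra sV Quot sym_ideal sV"

definition sym_V :: "('k::field \<Rightarrow> 'v::ab_group_add \<Rightarrow> 'v) \<Rightarrow> 'v \<Rightarrow> ('k, 'v) sym"
  where "sym_V sV v = sym_ideal sV +>\<^bsub>tensor_algebra sV\<^esub> tvec sV v"

definition sym_scalar :: "('k::field \<Rightarrow> 'v::ab_group_add \<Rightarrow> 'v) \<Rightarrow> 'k \<Rightarrow> ('k, 'v) sym"
  where "sym_scalar sV c = sym_ideal sV +>\<^bsub>tensor_algebra sV\<^esub> tscalar sV c"

text \<open>The library locale \<open>module\<close> assumes a commutative ring.\<close>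

locale left_module = R?: ring R + M?: abelian_group M
  for R :: "('r, 'b) ring_scheme" (structure) and M :: "('r, 'u, 'c) module_scheme" (structure) +
  assumes smult_closed:
      "\<lbrakk>a \<in> carrier R; x \<in> carrier M\<rbrakk> \<Longrightarrow> a \<odot>\<^bsub>M\<^esub> x \<in> carrier M"
    and smult_l_distr:
      "\<lbrakk>a \<in> carrier R; b \<in> carrier R; x \<in> carrier M\<rbrakk> \<Longrightarrow>
      (a \<oplus> b) \<odot>\<^bsub>M\<^esub> x = a \<odot>\<^bsub>M\<^esub> x \<oplus>\<^bsub>M\<^esub> b \<odot>\<^bsub>M\<^esub> x"
    and smult_r_distr:
      "\<lbrakk>a \<in> carrier R; x \<in> carrier M; y \<in> carrier M\<rbrakk> \<Longrightarrow>
      a \<odot>\<^bsub>M\<^esub> (x \<oplus>\<^bsub>M\<^esub> y) = a \<odot>\<^bsub>M\<^esub> x \<oplus>\<^bsub>M\<^esub> a \<odot>\<^bsub>M\<^esub> y"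
    and smult_assoc:
      "\<lbrakk>a \<in> carrier R; b \<in> carrier R; x \<in> carrier M\<rbrakk> \<Longrightarrow>
      (a \<otimes> b) \<odot>\<^bsub>M\<^esub> x = a \<odot>\<^bsub>M\<^esub> (b \<odot>\<^bsub>M\<^esub> x)"
    and smult_one:
      "x \<in> carrier M \<Longrightarrow> \<one> \<odot>\<^bsub>M\<^esub> x = x"

text \<open>
  A module is a record whose carrier is a subset of a type \<open>'u\<close>.  Simple modules over the algebras
  above are cyclic, hence quotients of the free algebra; so if that free algebra injects into \<open>'u\<close>,
  every simple module is isomorphic to one with carrier in \<open>'u\<close>.
\<close>

definition simple_modules :: "'r ring \<Rightarrow> ('r, 'u) module set"
  where "simple_modules R = {M. left_module R M \<and> carrier M \<noteq> {\<zero>\<^bsub>M\<^esub>} \<and>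
    (\<forall>N. submodule N R M \<longrightarrow> N = {\<zero>\<^bsub>M\<^esub>} \<or> N = carrier M)}"

definition module_iso :: "'r ring \<Rightarrow> ('r, 'u) module \<Rightarrow> ('r, 'u) module \<Rightarrow> bool"
  where "module_iso R M N \<longleftrightarrow> (\<exists>f. bij_betw f (carrier M) (carrier N) \<and>
    (\<forall>x\<in>carrier M. \<forall>y\<in>carrier M. f (x \<oplus>\<^bsub>M\<^esub> y) = f x \<oplus>\<^bsub>N\<^esub> f y) \<and>
    (\<forall>r\<in>carrier R. \<forall>x\<in>carrier M. f (r \<odot>\<^bsub>M\<^esub> x) = r \<odot>\<^bsub>N\<^esub> f x))"

definition simple_iso_rel :: "'r ring \<Rightarrow> (('r, 'u) module \<times> ('r, 'u) module) set"
  where "simple_iso_rel R =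
    {(M, N). M \<in> simple_modules R \<and> N \<in> simple_modules R \<and> module_iso R M N}"

text \<open>Here \<open>\<eta>\<close> is the structure map of the acting algebra, through which \<open>'k\<close> acts on \<open>M\<close>.\<close>

definition one_dimensional :: "('k \<Rightarrow> 'r) \<Rightarrow> ('r, 'u) module \<Rightarrow> bool"
  where "one_dimensional \<eta> M \<longleftrightarrow>
    (\<exists>x\<in>carrier M. x \<noteq> \<zero>\<^bsub>M\<^esub> \<and> carrier M = {\<eta> c \<odot>\<^bsub>M\<^esub> x | c. True})"

context smash_data
begin

definition killed_by :: "'a set \<Rightarrow> (('k, 'v, 'a) smash, 'u) module \<Rightarrow> bool"
  where "killed_by I M \<longleftrightarrow> (\<forall>a\<in>I. \<forall>x\<in>carrier M. smash_A a \<odot>\<^bsub>M\<^esub> x = \<zero>\<^bsub>M\<^esub>)"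

text \<open>
  \<open>M\<close> and \<open>N\<close> have the same underlying vector space and every \<open>v \<in> V\<close> acts in the same way on both,
  i.e. \<open>N\<close> is the restriction of \<open>M\<close> to the image of \<open>V\<close>.
\<close>

definition restricts_to ::
  "(('k, 'v, 'a) smash, 'u) module \<Rightarrow> (('k, 'v) sym, 'u) module \<Rightarrow> bool"
  where "restricts_to M N \<longleftrightarrow> carrier M = carrier N \<and>
    (\<forall>x\<in>carrier M. \<forall>y\<in>carrier M. x \<oplus>\<^bsub>M\<^esub> y = x \<oplus>\<^bsub>N\<^esub> y) \<and>
    (\<forall>x\<in>carrier M. \<forall>c. smash_scalar c \<odot>\<^bsub>M\<^esub> x = sym_scalar sV c \<odot>\<^bsub>N\<^esub> x) \<and>
    (\<forall>x\<in>carrier M. \<forall>v. smash_V v \<odot>\<^bsub>M\<^esub> x = sym_V sV v \<odot>\<^bsub>N\<^esub> x)"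

text \<open>
  Simple modules are taken up to isomorphism.  In the last clause, the module \<open>M\<close> with
  \<open>restricts_to M N\<close> and \<open>killed_by I M\<close> is the inflation of \<open>N\<close>.
\<close>

definition restriction_bijection ::
  "'a set \<Rightarrow> ((('k, 'v, 'a) smash, 'u) module set \<Rightarrow> (('k, 'v) sym, 'u) module set) \<Rightarrow> bool"
  where "restriction_bijection I \<Phi> \<longleftrightarrow>
    (let isoH = simple_iso_rel smash_algebra;
         isoS = simple_iso_rel (sym_algebra sV);
         classesH = simple_modules smash_algebra // isoH;
         classesS = simple_modules (sym_algebra sV) // isoS
     in bij_betw \<Phi> classesH classesS \<and>
        (\<forall>M \<in> simple_modules smash_algebra. \<exists>N \<in> simple_modules (sym_algebra sV).
           restricts_to M N \<and> \<Phi> (isoH `` {M}) = isoS `` {N}) \<and>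
        (\<forall>N \<in> simple_modules (sym_algebra sV). \<exists>M \<in> simple_modules smash_algebra.
           restricts_to M N \<and> killed_by I M \<and> inv_into classesH \<Phi> (isoS `` {N}) = isoH `` {M}))"

end

end

theory Submission
  imports Defs
begin

text \<open>
  Write \<open>\<epsilon>\<close> for the augmentation of \<open>A\<close> onto the ground field \<open>K\<close>, with kernel \<open>\<mm>\<close> (\<open>aug\<close> below).

  \<^emph>\<open>The powers of \<open>\<mm>\<close>.\<close>  The inclusion \<open>\<lambda>(\<mm>\<^sup>j, v) \<subseteq> \<mm>\<^sup>j\<close> is proved for all \<open>j\<close> at once, by induction on
  \<open>k\<close> with \<open>\<mm>\<^sup>k v = 0\<close>.  Let \<open>x \<in> \<mm>\<close>, and let \<open>b \<noteq> 0\<close> lie in the last nonzero power \<open>\<mm>\<^sup>n\<close>.  Then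
  \<open>b x = 0\<close>, so the product rule for \<open>\<lambda>\<close> reads \<open>0 = b \<lambda>(x, v) + \<Sum> \<lambda>(b, x\<^sub>1(v)) x\<^sub>2\<close>.  The vectors \<open>x\<^sub>1(v)\<close>
  are killed by \<open>\<mm>\<close> to the power \<open>k - 1\<close>, so by induction the sum lies in \<open>\<mm>\<^sup>n \<mm> = 0\<close>.  Hence
  \<open>b \<lambda>(x, v) = 0\<close>, and since \<open>b\<close> annihilates \<open>\<mm>\<close> this forces \<open>\<epsilon>(\<lambda>(x, v)) = 0\<close>, that is,
  \<open>\<lambda>(x, v) \<in> \<mm>\<close>.  With this the product rule for \<open>b x\<close>, now with \<open>b \<in> \<mm>\<^sup>j\<close>, gives the step from
  \<open>\<mm>\<^sup>j\<close> to the next power.  As \<open>\<mm>\<close> is nilpotent, every vector is reached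
  (\<open>lam_preserves_powers\<close>); this turns (2) into (1).

  \<^emph>\<open>The equivalences.\<close>  They all pass through the condition that \<open>\<lambda>(A, V)\<close> and the image of \<open>\<kappa>\<^sub>A\<close>
  lie in \<open>\<mm>\<close>.  On a one-dimensional module killed by \<open>\<mm>\<close> everything acts by scalars, with \<open>A\<close> acting
  through \<open>\<epsilon>\<close>, and the defining relations say that all \<open>\<lambda>(a, v)\<close> and \<open>\<kappa>\<^sub>A(v, w)\<close> act as zero
  (\<open>one_dimensional_killed_imp\<close>); so (3) implies the condition.  Conversely, assume the
  condition.  In a simple module the vectors killed by \<open>\<mm>\<close> form a submodule, because
  \<open>a v = \<Sum> a\<^sub>1(v) a\<^sub>2 + \<lambda>(a, v)\<close> with \<open>a\<^sub>2, \<lambda>(a, v) \<in> \<mm>\<close> for \<open>a \<in> \<mm>\<close>, and this submodule is nonzero by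
  nilpotency; hence \<open>\<mm>\<close> kills the module (\<open>simple_module_killed\<close>).  Now \<open>A\<close> acts through \<open>\<epsilon>\<close> and the
  elements of \<open>V\<close> commute, so the module is the same thing as a \<open>Sym(V)\<close>-module, with the same
  submodules and homomorphisms.  In the other direction a \<open>Sym(V)\<close>-module inflates, since
  \<open>\<Sum> \<epsilon>(a\<^sub>2) a\<^sub>1(v) = \<epsilon>(a) v\<close>.  This is (4).  Finally, (4) applied to the field \<open>K\<close> with \<open>V\<close> acting as
  zero gives (3).  Under the product rule \<open>\<lambda>(1, v) = 0\<close>, so (2) is already equivalent to the
  condition; in general it has to be complemented by \<open>\<lambda>(1, V) \<subseteq> \<mm>\<close>.

  \<^emph>\<open>The algebras.\<close>  The smash product and \<open>Sym(V)\<close> are quotients of tensor algebras by generators and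
  relations.  A module over such a quotient is a linear family of operators satisfying the
  relations (\<open>linear_operators_of_module\<close>, \<open>module_of_linear_operators\<close>), so that all modules
  above are constructed and compared on generators only.
\<close>

section \<open>Left modules and quotients by annihilating ideals\<close>

lemma type_algebra_simps [simp]:
  "carrier ring_of_type_algebra = UNIV"
  "monoid.mult ring_of_type_algebra x y = x * y"
  "ring.add ring_of_type_algebra x y = x + y"
  "monoid.one ring_of_type_algebra = 1"
  "ring.zero ring_of_type_algebra = 0"
  by (simp_all add: ring_of_type_algebra_def)

lemma ring_type_algebra: "ring (ring_of_type_algebra :: 'a::ring_1 ring)"
proof (rule ringI)
  show "abelian_group (ring_of_type_algebra :: 'a ring)"
    by (rule abelian_groupI) (auto simp: algebra_simps intro: exI[of _ "- x" for x])
  show "Group.monoid (ring_of_type_algebra :: 'a ring)"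
    by (rule monoidI) (auto simp: algebra_simps)
qed (auto simp: algebra_simps)

lemma a_minus_type_algebra [simp]:
  "(x :: 'a::ring_1) \<ominus>\<^bsub>ring_of_type_algebra\<^esub> y = x - y"
proof -
  interpret ring "ring_of_type_algebra :: 'a ring" by (rule ring_type_algebra)
  have "\<ominus>\<^bsub>ring_of_type_algebra\<^esub> y = - y"
    by (rule minus_equality) auto
  then show ?thesis by (simp add: a_minus_def)
qed

lemma abelian_group_cong:
  assumes "abelian_group G"
    and "carrier H = carrier G" "ring.zero H = ring.zero G" "ring.add H = ring.add G"
  shows "abelian_group H"
proof -
  interpret abelian_group G by fact
  show ?thesis
    by (rule abelian_groupI) (use assms l_neg in \<open>auto simp: a_ac intro: a_inv_closed\<close>)
qed

context left_module
begin

lemma smult_l_null: "x \<in> carrier M \<Longrightarrow> \<zero> \<odot>\<^bsub>M\<^esub> x = \<zero>\<^bsub>M\<^esub>"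
  using smult_l_distr[of \<zero> \<zero> x] smult_closed[of \<zero> x] M.add.l_cancel_one' by fastforce

lemma smult_r_null: "a \<in> carrier R \<Longrightarrow> a \<odot>\<^bsub>M\<^esub> \<zero>\<^bsub>M\<^esub> = \<zero>\<^bsub>M\<^esub>"
  using smult_r_distr[of a "\<zero>\<^bsub>M\<^esub>" "\<zero>\<^bsub>M\<^esub>"] smult_closed[of a "\<zero>\<^bsub>M\<^esub>"] M.add.l_cancel_one'
  by fastforce

lemma smult_l_minus:
  assumes "a \<in> carrier R" "x \<in> carrier M"
  shows "(\<ominus> a) \<odot>\<^bsub>M\<^esub> x = \<ominus>\<^bsub>M\<^esub> (a \<odot>\<^bsub>M\<^esub> x)"
proof -
  have "(\<ominus> a) \<odot>\<^bsub>M\<^esub> x \<oplus>\<^bsub>M\<^esub> a \<odot>\<^bsub>M\<^esub> x = \<zero>\<^bsub>M\<^esub>"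
    using assms by (simp flip: smult_l_distr add: R.l_neg smult_l_null)
  then show ?thesis
    using assms by (metis M.minus_equality R.a_inv_closed smult_closed)
qed

lemma smult_l_diff:
  assumes "a \<in> carrier R" "b \<in> carrier R" "x \<in> carrier M"
  shows "(a \<ominus> b) \<odot>\<^bsub>M\<^esub> x = a \<odot>\<^bsub>M\<^esub> x \<ominus>\<^bsub>M\<^esub> b \<odot>\<^bsub>M\<^esub> x"
  using assms by (simp add: R.minus_eq M.minus_eq smult_l_distr smult_l_minus)

lemma smult_list_sum:
  assumes "set rs \<subseteq> carrier R" "x \<in> carrier M"
  shows "list_sum R rs \<in> carrier R \<and>
    list_sum R rs \<odot>\<^bsub>M\<^esub> x = list_sum M (map (\<lambda>r. r \<odot>\<^bsub>M\<^esub> x) rs)"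
  using assms
  by (induction rs) (auto simp: list_sum_def smult_l_null smult_l_distr)

lemma ideal_annihilator: "ideal {r \<in> carrier R. \<forall>x\<in>carrier M. r \<odot>\<^bsub>M\<^esub> x = \<zero>\<^bsub>M\<^esub>} R" (is "ideal ?I R")
proof (rule idealI)
  show "ring R" by (rule R.ring_axioms)
  show "subgroup ?I (add_monoid R)"
    by (rule R.add.subgroupI)
      (auto simp: smult_l_null smult_l_minus smult_l_distr simp flip: a_inv_def)
qed (auto simp: smult_assoc smult_r_null smult_closed)

text \<open>
  The annihilator of a module is an ideal, so it contains the ideal generated by any relations that
  act as zero; checking the defining relations is therefore enough.
\<close>

lemma genideal_annihilates:
  assumes "S \<subseteq> carrier R" "\<And>r x. r \<in> S \<Longrightarrow> x \<in> carrier M \<Longrightarrow> r \<odot>\<^bsub>M\<^esub> x = \<zero>\<^bsub>M\<^esub>"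
    and "r \<in> Idl S" "x \<in> carrier M"
  shows "r \<odot>\<^bsub>M\<^esub> x = \<zero>\<^bsub>M\<^esub>"
  using R.genideal_minimal[OF ideal_annihilator, of S] assms by blast

lemma submoduleI_closed:
  assumes "H \<subseteq> carrier M" "\<zero>\<^bsub>M\<^esub> \<in> H"
    and "\<And>x y. x \<in> H \<Longrightarrow> y \<in> H \<Longrightarrow> x \<oplus>\<^bsub>M\<^esub> y \<in> H"
    and "\<And>r x. r \<in> carrier R \<Longrightarrow> x \<in> H \<Longrightarrow> r \<odot>\<^bsub>M\<^esub> x \<in> H"
  shows "submodule H R M"
proof -
  have "\<ominus>\<^bsub>M\<^esub> x \<in> H" if "x \<in> H" for x
  proof -
    have "(\<ominus> \<one>) \<odot>\<^bsub>M\<^esub> x \<in> H" using that assms(4) by simp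
    then show ?thesis using that assms(1) by (simp add: smult_l_minus smult_one subset_eq)
  qed
  then have "subgroup H (add_monoid M)"
    using assms by (intro M.add.subgroupI) (auto simp flip: a_inv_def)
  then show ?thesis
    using assms by (auto simp: submodule_def submodule_axioms_def)
qed

end

lemma list_sum_closed:
  assumes "abelian_monoid M" "set xs \<subseteq> carrier M"
  shows "list_sum M xs \<in> carrier M"
proof -
  interpret abelian_monoid M by fact
  show ?thesis using assms(2) by (induction xs) (auto simp: list_sum_def)
qed

lemma submodule_facts:
  assumes "submodule H R M"
  shows "H \<subseteq> carrier M" "\<zero>\<^bsub>M\<^esub> \<in> H"
    and "\<And>x y. x \<in> H \<Longrightarrow> y \<in> H \<Longrightarrow> x \<oplus>\<^bsub>M\<^esub> y \<in> H"
    and "\<And>r x. r \<in> carrier R \<Longrightarrow> x \<in> H \<Longrightarrow> r \<odot>\<^bsub>M\<^esub> x \<in> H"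
proof -
  interpret submodule H R M by fact
  show "H \<subseteq> carrier M" using subset by simp
  show "\<zero>\<^bsub>M\<^esub> \<in> H" using one_closed by simp
  show "\<And>x y. x \<in> H \<Longrightarrow> y \<in> H \<Longrightarrow> x \<oplus>\<^bsub>M\<^esub> y \<in> H" using m_closed by simp
  show "\<And>r x. r \<in> carrier R \<Longrightarrow> x \<in> H \<Longrightarrow> r \<odot>\<^bsub>M\<^esub> x \<in> H" by simp
qed

text \<open>
  A coset acts through an arbitrary representative.  This is independent of the choice only if the
  ideal annihilates the module, which the lemmas below assume.
\<close>

definition quotient_module :: "('r, 'u) module \<Rightarrow> ('r set, 'u) module"
  where "quotient_module M =
    \<lparr>carrier = carrier M, monoid.mult = monoid.mult M, one = monoid.one M, zero = ring.zero M, add = ring.add M,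
     module.smult = (\<lambda>Y x. (SOME r. r \<in> Y) \<odot>\<^bsub>M\<^esub> x)\<rparr>"

lemma quotient_module_simps [simp]:
  "carrier (quotient_module M) = carrier M"
  "ring.zero (quotient_module M) = ring.zero M"
  "ring.add (quotient_module M) = ring.add M"
  by (simp_all add: quotient_module_def)

lemma quotient_module_smult:
  assumes "left_module R M" "ideal I R"
    and null: "\<And>r x. r \<in> I \<Longrightarrow> x \<in> carrier M \<Longrightarrow> r \<odot>\<^bsub>M\<^esub> x = \<zero>\<^bsub>M\<^esub>"
    and "r \<in> carrier R" "x \<in> carrier M"
  shows "(I +>\<^bsub>R\<^esub> r) \<odot>\<^bsub>quotient_module M\<^esub> x = r \<odot>\<^bsub>M\<^esub> x"
proof -
  interpret left_module R M by fact
  interpret I: ideal I R by fact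
  have "(SOME s. s \<in> I +>\<^bsub>R\<^esub> r) \<in> I +>\<^bsub>R\<^esub> r"
    using I.a_rcos_self[OF assms(4)] by (rule someI)
  then obtain h where h: "h \<in> I" "(SOME s. s \<in> I +>\<^bsub>R\<^esub> r) = h \<oplus>\<^bsub>R\<^esub> r"
    by (auto simp: a_r_coset_def')
  show ?thesis
    using h assms(4,5) null[of h x] I.Icarr[of h]
    by (simp add: quotient_module_def smult_l_distr smult_closed)
qed

lemma left_module_quotient:
  assumes M: "left_module R M" and I: "ideal I R"
    and null: "\<And>r x. r \<in> I \<Longrightarrow> x \<in> carrier M \<Longrightarrow> r \<odot>\<^bsub>M\<^esub> x = \<zero>\<^bsub>M\<^esub>"
  shows "left_module (R Quot I) (quotient_module M)"
proof -
  interpret left_module R M by fact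
  interpret I: ideal I R by fact
  note sm = quotient_module_smult[OF M I null]
  have rep: "\<exists>r\<in>carrier R. Y = I +>\<^bsub>R\<^esub> r" if "Y \<in> carrier (R Quot I)" for Y
    using that by (auto simp: FactRing_def A_RCOSETS_def')
  interpret h: ring_hom_ring R "R Quot I" "(+>\<^bsub>R\<^esub>) I" by (rule I.rcos_ring_hom_ring)
  show ?thesis
  proof (intro left_module.intro left_module_axioms.intro)
    show "ring (R Quot I)" by (rule I.quotient_is_ring)
    show "abelian_group (quotient_module M)"
      by (rule abelian_group_cong[OF M.abelian_group_axioms]) auto
  qed (auto dest!: rep simp: sm smult_closed smult_l_distr smult_r_distr smult_assoc smult_one
        simp flip: h.hom_add h.hom_mult h.hom_one)
qed

lemma quotient_ring_cases:
  assumes "c \<in> carrier (R Quot I)"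
  obtains r where "r \<in> carrier R" "c = I +>\<^bsub>R\<^esub> r"
  using assms by (auto simp: FactRing_def A_RCOSETS_def')

lemma quotient_ring_zero: "\<zero>\<^bsub>R Quot I\<^esub> = I"
  by (simp add: FactRing_def)

definition pullback_module :: "('r \<Rightarrow> 's) \<Rightarrow> ('s, 'u) module \<Rightarrow> ('r, 'u) module"
  where "pullback_module h M =
    \<lparr>carrier = carrier M, monoid.mult = monoid.mult M, one = monoid.one M, ring.zero = ring.zero M,
     ring.add = ring.add M, module.smult = (\<lambda>r x. h r \<odot>\<^bsub>M\<^esub> x)\<rparr>"

lemma pullback_module_simps [simp]:
  "carrier (pullback_module h M) = carrier M"
  "ring.zero (pullback_module h M) = ring.zero M"
  "ring.add (pullback_module h M) = ring.add M"
  "r \<odot>\<^bsub>pullback_module h M\<^esub> x = h r \<odot>\<^bsub>M\<^esub> x"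
  by (simp_all add: pullback_module_def)

text \<open>
  Pulling a module back from a quotient of the tensor algebra to the tensor algebra turns the
  relations of the quotient into elements that act as zero.
\<close>

lemma left_module_pullback:
  assumes "ring_hom_ring R S h" "left_module S M"
  shows "left_module R (pullback_module h M)"
proof -
  interpret h: ring_hom_ring R S h by fact
  interpret M: left_module S M by fact
  show ?thesis
  proof (intro left_module.intro left_module_axioms.intro)
    show "abelian_group (pullback_module h M)"
      by (rule abelian_group_cong[OF M.M.abelian_group_axioms]) auto
  qed (auto simp: h.R.ring_axioms M.smult_closed M.smult_l_distr M.smult_r_distr M.smult_assoc
      M.smult_one)
qed

lemma (in abelian_group) minus_eq_zero_iff:
  assumes "a \<in> carrier G" "b \<in> carrier G"
  shows "a \<ominus> b = \<zero> \<longleftrightarrow> a = b"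
  using assms by (metis a_inv_closed minus_eq minus_equality minus_minus r_neg)

lemma (in abelian_group) minus_minus_eq_zero_iff:
  assumes "a \<in> carrier G" "b \<in> carrier G" "c \<in> carrier G"
  shows "a \<ominus> b \<ominus> c = \<zero> \<longleftrightarrow> a = b \<oplus> c"
proof -
  have "a \<ominus> b \<ominus> c = a \<ominus> (b \<oplus> c)"
    using assms by (simp add: minus_eq minus_add a_assoc)
  then show ?thesis using assms by (simp add: minus_eq_zero_iff)
qed

lemma list_sum_pullback [simp]: "list_sum (pullback_module h M) = list_sum M"
  by (simp add: list_sum_def[abs_def])

section \<open>The tensor algebra\<close>

lemma poly_mapping_single_induct [case_names single add]:
  assumes single: "\<And>w c. P (Poly_Mapping.single w c)"
    and add: "\<And>p q. P p \<Longrightarrow> P q \<Longrightarrow> P (p + q)"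
  shows "P p"
proof (induction p rule: update_induct)
  case const
  show ?case using single[of undefined 0] by simp
next
  case (update f a b)
  have "Poly_Mapping.update a b f = f + Poly_Mapping.single a b"
    using update(1)
    by (intro poly_mapping_eqI) (auto simp: lookup_update lookup_add lookup_single in_keys_iff when_def)
  then show ?case using update single add by simp
qed

context
  fixes s :: "'k::field \<Rightarrow> 'w::ab_group_add \<Rightarrow> 'w"
begin

lemma ideal_linearity_ideal: "ideal (linearity_ideal s) ring_of_type_algebra"
proof -
  interpret ring "ring_of_type_algebra :: ('w list \<Rightarrow>\<^sub>0 'k) ring" by (rule ring_type_algebra)
  show ?thesis unfolding linearity_ideal_def by (rule genideal_ideal) simp
qed

lemma ring_tensor_algebra: "ring (tensor_algebra s)"
  unfolding tensor_algebra_def by (rule ideal.quotient_is_ring[OF ideal_linearity_ideal])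

lemma tensor_hom:
  "ring_hom_ring ring_of_type_algebra (tensor_algebra s) ((+>\<^bsub>ring_of_type_algebra\<^esub>) (linearity_ideal s))"
  unfolding tensor_algebra_def by (rule ideal.rcos_ring_hom_ring[OF ideal_linearity_ideal])

text \<open>
  Elements of the tensor algebra are cosets of noncommutative polynomials, so identities between
  them are congruences modulo the linearity relations.
\<close>

lemma tensor_eqI:
  assumes "p - q \<in> linearity_ideal s"
  shows "linearity_ideal s +>\<^bsub>ring_of_type_algebra\<^esub> p = linearity_ideal s +>\<^bsub>ring_of_type_algebra\<^esub> q"
proof -
  interpret ring "ring_of_type_algebra :: ('w list \<Rightarrow>\<^sub>0 'k) ring" by (rule ring_type_algebra)
  show ?thesis
    using assms quotient_eq_iff_same_a_r_cos[OF ideal_linearity_ideal, of p q] by simp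
qed

lemma linearity_ideal_generators:
  shows "Poly_Mapping.single [x + y] 1 - Poly_Mapping.single [x] 1 - Poly_Mapping.single [y] 1
      \<in> linearity_ideal s"
    and "Poly_Mapping.single [s c x] 1 - Poly_Mapping.single [x] c \<in> linearity_ideal s"
proof -
  interpret ring "ring_of_type_algebra :: ('w list \<Rightarrow>\<^sub>0 'k) ring" by (rule ring_type_algebra)
  show "Poly_Mapping.single [x + y] 1 - Poly_Mapping.single [x] 1 - Poly_Mapping.single [y] 1
      \<in> linearity_ideal s"
    "Poly_Mapping.single [s c x] 1 - Poly_Mapping.single [x] c \<in> linearity_ideal s"
    unfolding linearity_ideal_def by (rule set_mp[OF genideal_self]; auto)+
qed

lemma tvec_closed: "tvec s w \<in> carrier (tensor_algebra s)"
  and tscalar_closed: "tscalar s c \<in> carrier (tensor_algebra s)"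
  using ring_hom_ring.homh[OF tensor_hom]
  by (auto simp: tvec_def tscalar_def ring_hom_def)

lemma tvec_add: "tvec s (v + w) = tvec s v \<oplus>\<^bsub>tensor_algebra s\<^esub> tvec s w"
proof -
  interpret h: ring_hom_ring ring_of_type_algebra "tensor_algebra s"
    "(+>\<^bsub>ring_of_type_algebra\<^esub>) (linearity_ideal s)" by (rule tensor_hom)
  show ?thesis
    using h.hom_add[of "Poly_Mapping.single [v] 1" "Poly_Mapping.single [w] 1"]
      tensor_eqI[OF linearity_ideal_generators(1)[of v w, unfolded diff_diff_eq]]
    by (simp add: tvec_def)
qed

lemma tscalar_tvec:
  "tscalar s c \<otimes>\<^bsub>tensor_algebra s\<^esub> tvec s w =
    linearity_ideal s +>\<^bsub>ring_of_type_algebra\<^esub> Poly_Mapping.single [w] c"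
  "tvec s w \<otimes>\<^bsub>tensor_algebra s\<^esub> tscalar s c =
    linearity_ideal s +>\<^bsub>ring_of_type_algebra\<^esub> Poly_Mapping.single [w] c"
proof -
  interpret h: ring_hom_ring ring_of_type_algebra "tensor_algebra s"
    "(+>\<^bsub>ring_of_type_algebra\<^esub>) (linearity_ideal s)" by (rule tensor_hom)
  show "tscalar s c \<otimes>\<^bsub>tensor_algebra s\<^esub> tvec s w =
      linearity_ideal s +>\<^bsub>ring_of_type_algebra\<^esub> Poly_Mapping.single [w] c"
    "tvec s w \<otimes>\<^bsub>tensor_algebra s\<^esub> tscalar s c =
      linearity_ideal s +>\<^bsub>ring_of_type_algebra\<^esub> Poly_Mapping.single [w] c"
    by (simp_all add: tvec_def tscalar_def mult_single plus_list_def flip: h.hom_mult)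
qed

lemma tvec_scale: "tvec s (s c w) = tscalar s c \<otimes>\<^bsub>tensor_algebra s\<^esub> tvec s w"
  unfolding tscalar_tvec unfolding tvec_def by (rule tensor_eqI) (rule linearity_ideal_generators)

lemma tscalar_tvec_commute:
  "tscalar s c \<otimes>\<^bsub>tensor_algebra s\<^esub> tvec s w = tvec s w \<otimes>\<^bsub>tensor_algebra s\<^esub> tscalar s c"
  by (simp only: tscalar_tvec)

lemma tscalar_add: "tscalar s (c + d) = tscalar s c \<oplus>\<^bsub>tensor_algebra s\<^esub> tscalar s d"
  and tscalar_mult: "tscalar s (c * d) = tscalar s c \<otimes>\<^bsub>tensor_algebra s\<^esub> tscalar s d"
  and tscalar_one: "tscalar s 1 = \<one>\<^bsub>tensor_algebra s\<^esub>"
proof -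
  interpret h: ring_hom_ring ring_of_type_algebra "tensor_algebra s"
    "(+>\<^bsub>ring_of_type_algebra\<^esub>) (linearity_ideal s)" by (rule tensor_hom)
  show "tscalar s (c + d) = tscalar s c \<oplus>\<^bsub>tensor_algebra s\<^esub> tscalar s d"
    "tscalar s (c * d) = tscalar s c \<otimes>\<^bsub>tensor_algebra s\<^esub> tscalar s d"
    by (simp_all add: tscalar_def mult_single plus_list_def single_add flip: h.hom_mult h.hom_add)
  show "tscalar s 1 = \<one>\<^bsub>tensor_algebra s\<^esub>"
    using h.hom_one by (simp add: tscalar_def flip: single_one zero_list_def)
qed

text \<open>
  The tensor algebra is generated as a ring by scalars and vectors, since every word is a product of
  letters.
\<close>

lemma tensor_induct [consumes 1, case_names tscalar tvec add mult]:
  assumes "t \<in> carrier (tensor_algebra s)"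
    and scalar: "\<And>c. P (tscalar s c)" and vec: "\<And>w. P (tvec s w)"
    and plus: "\<And>t t'. \<lbrakk>t \<in> carrier (tensor_algebra s); t' \<in> carrier (tensor_algebra s); P t; P t'\<rbrakk>
      \<Longrightarrow> P (t \<oplus>\<^bsub>tensor_algebra s\<^esub> t')"
    and mult: "\<And>t t'. \<lbrakk>t \<in> carrier (tensor_algebra s); t' \<in> carrier (tensor_algebra s); P t; P t'\<rbrakk>
      \<Longrightarrow> P (t \<otimes>\<^bsub>tensor_algebra s\<^esub> t')"
  shows "P t"
proof -
  interpret h: ring_hom_ring ring_of_type_algebra "tensor_algebra s"
    "(+>\<^bsub>ring_of_type_algebra\<^esub>) (linearity_ideal s)" by (rule tensor_hom)
  obtain p where p: "t = linearity_ideal s +>\<^bsub>ring_of_type_algebra\<^esub> p"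
    using assms(1) by (auto simp: tensor_algebra_def FactRing_def A_RCOSETS_def')
  have "P (linearity_ideal s +>\<^bsub>ring_of_type_algebra\<^esub> p)"
  proof (induction p rule: poly_mapping_single_induct)
    case (single ws c)
    show ?case
    proof (induction ws arbitrary: c)
      case Nil
      show ?case using scalar by (simp add: tscalar_def)
    next
      case (Cons w ws)
      have "Poly_Mapping.single (w # ws) c = Poly_Mapping.single [w] 1 * Poly_Mapping.single ws c"
        by (simp add: mult_single plus_list_def)
      then show ?case
        using mult[OF _ _ vec[of w] Cons[of c]] by (simp add: tvec_def flip: h.hom_mult)
    qed
  next
    case (add p q)
    then show ?case
      using plus[OF h.hom_closed h.hom_closed, of p q] h.hom_add[of p q] by simp
  qed
  then show ?thesis using p by simp
qed

end

section \<open>Modules over the tensor algebra from linear operators\<close>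

text \<open>
  A representation of the vector space \<open>(W, s)\<close>: a linear family of linear operators on \<open>M\<close>.
  The scalars act by \<open>scal\<close>, because \<open>M\<close> is a bare abelian group on a subset of a type.
\<close>

locale linear_operators = M: abelian_group M + W: vector_space s
  for M :: "('u, 'e) ring_scheme" and s :: "'k::field \<Rightarrow> 'w::ab_group_add \<Rightarrow> 'w" +
  fixes scal :: "'k \<Rightarrow> 'u \<Rightarrow> 'u" and opr :: "'w \<Rightarrow> 'u \<Rightarrow> 'u"
  assumes scal_closed: "x \<in> carrier M \<Longrightarrow> scal c x \<in> carrier M"
    and scal_r_distr: "\<lbrakk>x \<in> carrier M; y \<in> carrier M\<rbrakk> \<Longrightarrow>
      scal c (x \<oplus>\<^bsub>M\<^esub> y) = scal c x \<oplus>\<^bsub>M\<^esub> scal c y"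
    and scal_l_distr: "x \<in> carrier M \<Longrightarrow> scal (c + d) x = scal c x \<oplus>\<^bsub>M\<^esub> scal d x"
    and scal_mult: "x \<in> carrier M \<Longrightarrow> scal (c * d) x = scal c (scal d x)"
    and scal_one: "x \<in> carrier M \<Longrightarrow> scal 1 x = x"
    and opr_closed: "x \<in> carrier M \<Longrightarrow> opr w x \<in> carrier M"
    and opr_r_distr: "\<lbrakk>x \<in> carrier M; y \<in> carrier M\<rbrakk> \<Longrightarrow>
      opr w (x \<oplus>\<^bsub>M\<^esub> y) = opr w x \<oplus>\<^bsub>M\<^esub> opr w y"
    and opr_scal: "x \<in> carrier M \<Longrightarrow> opr w (scal c x) = scal c (opr w x)"
    and opr_l_distr: "x \<in> carrier M \<Longrightarrow> opr (v + w) x = opr v x \<oplus>\<^bsub>M\<^esub> opr w x"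
    and opr_scale: "x \<in> carrier M \<Longrightarrow> opr (s c w) x = scal c (opr w x)"
begin

definition word_act :: "'w list \<Rightarrow> 'u \<Rightarrow> 'u"
  where "word_act ws x = foldr opr ws x"

definition free_act :: "('w list \<Rightarrow>\<^sub>0 'k) \<Rightarrow> 'u \<Rightarrow> 'u"
  where "free_act p x =
    (\<Oplus>\<^bsub>M\<^esub>w\<in>Poly_Mapping.keys p. scal (Poly_Mapping.lookup p w) (word_act w x))"

definition free_module :: "('w list \<Rightarrow>\<^sub>0 'k, 'u) module"
  where "free_module =
    \<lparr>carrier = carrier M, monoid.mult = monoid.mult M, one = monoid.one M, zero = ring.zero M, add = ring.add M,
     module.smult = free_act\<rparr>"

lemma free_module_simps [simp]:
  "carrier free_module = carrier M" "ring.zero free_module = ring.zero M" "ring.add free_module = ring.add M"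
  "module.smult free_module = free_act"
  by (simp_all add: free_module_def)

lemma scal_zero: "x \<in> carrier M \<Longrightarrow> scal 0 x = \<zero>\<^bsub>M\<^esub>"
  using scal_l_distr[of x 0 0] scal_closed[of x 0] M.add.l_cancel_one' by fastforce

lemma word_act_closed: "x \<in> carrier M \<Longrightarrow> word_act ws x \<in> carrier M"
  by (induction ws) (auto simp: word_act_def opr_closed)

lemma word_act_add:
  "\<lbrakk>x \<in> carrier M; y \<in> carrier M\<rbrakk> \<Longrightarrow>
    word_act ws (x \<oplus>\<^bsub>M\<^esub> y) = word_act ws x \<oplus>\<^bsub>M\<^esub> word_act ws y"
  using word_act_closed by (induction ws) (auto simp: word_act_def opr_closed opr_r_distr)

lemma word_act_scal: "x \<in> carrier M \<Longrightarrow> word_act ws (scal c x) = scal c (word_act ws x)"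
  using word_act_closed by (induction ws) (auto simp: word_act_def opr_closed opr_scal)

text \<open>
  Enlarging the index set of the defining sum makes it possible to add two polynomials with different
  supports.
\<close>

lemma free_act_superset:
  assumes "finite K" "Poly_Mapping.keys p \<subseteq> K" "x \<in> carrier M"
  shows "free_act p x = (\<Oplus>\<^bsub>M\<^esub>w\<in>K. scal (Poly_Mapping.lookup p w) (word_act w x))"
  unfolding free_act_def
  using assms by (intro M.add.finprod_mono_neutral_cong_left)
    (auto simp: in_keys_iff scal_zero scal_closed word_act_closed)

lemma free_act_closed: "x \<in> carrier M \<Longrightarrow> free_act p x \<in> carrier M"
  unfolding free_act_def by (intro M.finsum_closed) (auto simp: scal_closed word_act_closed)

lemma free_act_add:
  assumes "x \<in> carrier M"
  shows "free_act (p + q) x = free_act p x \<oplus>\<^bsub>M\<^esub> free_act q x"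
proof -
  let ?K = "Poly_Mapping.keys p \<union> Poly_Mapping.keys q"
  have "free_act (p + q) x =
      (\<Oplus>\<^bsub>M\<^esub>w\<in>?K. scal (Poly_Mapping.lookup p w) (word_act w x) \<oplus>\<^bsub>M\<^esub> scal (Poly_Mapping.lookup q w) (word_act w x))"
    using assms keys_add[of p q]
    by (subst free_act_superset[where K = ?K])
      (auto simp: lookup_add scal_l_distr scal_closed word_act_closed intro!: M.finsum_cong')
  also have "\<dots> = free_act p x \<oplus>\<^bsub>M\<^esub> free_act q x"
    using assms
    by (subst M.finsum_addf) (auto simp: scal_closed word_act_closed free_act_superset[where K = ?K])
  finally show ?thesis .
qed

lemma free_act_single:
  assumes "x \<in> carrier M"
  shows "free_act (Poly_Mapping.single ws c) x = scal c (word_act ws x)"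
  using assms
  by (subst free_act_superset[where K = "{ws}"])
    (auto simp: M.finsum_insert scal_closed word_act_closed)

lemma free_act_r_distr:
  assumes "x \<in> carrier M" "y \<in> carrier M"
  shows "free_act p (x \<oplus>\<^bsub>M\<^esub> y) = free_act p x \<oplus>\<^bsub>M\<^esub> free_act p y"
proof (induction p rule: poly_mapping_single_induct)
  case (single w c)
  then show ?case
    using assms by (simp add: free_act_single word_act_add scal_r_distr word_act_closed)
next
  case (add p q)
  then show ?case
    using assms by (simp add: free_act_add free_act_closed M.a_ac)
qed

lemma free_act_mult:
  assumes "x \<in> carrier M"
  shows "free_act (p * q) x = free_act p (free_act q x)"
proof (induction p rule: poly_mapping_single_induct)
  case (single v c)
  show ?case
  proof (induction q rule: poly_mapping_single_induct)
    case (single w d)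
    then show ?case
      using assms
      by (simp add: mult_single free_act_single word_act_scal scal_closed word_act_closed scal_mult)
        (simp add: word_act_def plus_list_def)
  next
    case (add p q)
    then show ?case
      using assms by (simp add: distrib_left free_act_add free_act_closed free_act_r_distr)
  qed
next
  case (add p q)
  then show ?case
    using assms by (simp add: distrib_right free_act_add free_act_closed)
qed

lemma free_act_one: "x \<in> carrier M \<Longrightarrow> free_act 1 x = x"
  by (simp flip: single_one add: free_act_single scal_one word_act_closed)
    (simp add: word_act_def zero_list_def)

lemma left_module_free: "left_module ring_of_type_algebra free_module"
proof (intro left_module.intro left_module_axioms.intro)
  show "abelian_group free_module"
    by (rule abelian_group_cong[OF M.abelian_group_axioms]) auto
qed (auto simp: ring_type_algebra free_act_closed free_act_add free_act_r_distr free_act_mult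
    free_act_one)

definition tensor_module :: "(('k, 'w) tensor, 'u) module"
  where "tensor_module = quotient_module free_module"

lemma tensor_module_simps [simp]:
  "carrier tensor_module = carrier M" "ring.zero tensor_module = ring.zero M" "ring.add tensor_module = ring.add M"
  by (simp_all add: tensor_module_def)

text \<open>
  The linearity of \<open>opr\<close> in the vector says exactly that the two families of linearity relations act
  as zero.
\<close>

lemma free_act_linearity_ideal:
  assumes "p \<in> linearity_ideal s" "x \<in> carrier M"
  shows "free_act p x = \<zero>\<^bsub>M\<^esub>"
proof -
  interpret F: left_module ring_of_type_algebra free_module by (rule left_module_free)
  have diff: "free_act (p - q) x = free_act p x \<ominus>\<^bsub>M\<^esub> free_act q x" if "x \<in> carrier M" for p q x
  proof -
    have "free_act p x = free_act (p - q) x \<oplus>\<^bsub>M\<^esub> free_act q x"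
      using free_act_add[OF that, of "p - q" q] by simp
    then show ?thesis
      using that by (simp add: M.minus_eq M.a_assoc free_act_closed M.r_neg)
  qed
  have letter: "free_act (Poly_Mapping.single [w] c) x = scal c (opr w x)"
    if "x \<in> carrier M" for c w x
    using that by (simp add: free_act_single word_act_def)
  have cancel: "(a \<oplus>\<^bsub>M\<^esub> b) \<ominus>\<^bsub>M\<^esub> a \<ominus>\<^bsub>M\<^esub> b = \<zero>\<^bsub>M\<^esub>" "a \<ominus>\<^bsub>M\<^esub> a = \<zero>\<^bsub>M\<^esub>"
    if "a \<in> carrier M" "b \<in> carrier M" for a b
    using that M.r_neg1[of a b]
    by (simp_all add: M.minus_eq M.a_assoc M.r_neg M.a_comm[of b "\<ominus>\<^bsub>M\<^esub> a \<oplus>\<^bsub>M\<^esub> \<ominus>\<^bsub>M\<^esub> b"] M.l_neg)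
  have "p \<odot>\<^bsub>free_module\<^esub> x = \<zero>\<^bsub>free_module\<^esub>"
  proof (rule F.genideal_annihilates[OF _ _ assms(1)[unfolded linearity_ideal_def]], goal_cases)
    case (2 r x)
    then show ?case
      by (auto simp: diff letter scal_one opr_closed opr_l_distr opr_scale
          scal_closed cancel)
  qed (use assms in auto)
  then show ?thesis by simp
qed

lemma left_module_tensor: "left_module (tensor_algebra s) tensor_module"
  unfolding tensor_algebra_def tensor_module_def
  using free_act_linearity_ideal ideal_linearity_ideal
  by (intro left_module_quotient left_module_free) auto

lemma tvec_smult: "x \<in> carrier M \<Longrightarrow> tvec s w \<odot>\<^bsub>tensor_module\<^esub> x = opr w x"
  unfolding tvec_def tensor_module_def
  using free_act_linearity_ideal ideal_linearity_ideal
  by (subst quotient_module_smult[OF left_module_free])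
    (auto simp: free_act_single word_act_def scal_one opr_closed)

lemma tscalar_smult: "x \<in> carrier M \<Longrightarrow> tscalar s c \<odot>\<^bsub>tensor_module\<^esub> x = scal c x"
  unfolding tscalar_def tensor_module_def
  using free_act_linearity_ideal ideal_linearity_ideal
  by (subst quotient_module_smult[OF left_module_free])
    (auto simp: free_act_single word_act_def)

end

section \<open>Presented quotients of the tensor algebra\<close>

text \<open>
  The algebra presented by the vector space \<open>(W, s)\<close> and the relations \<open>G\<close>.  Both the deformed smash
  product and the symmetric algebra are of this form.
\<close>

locale tensor_quotient = W: vector_space s
  for s :: "'k::field \<Rightarrow> 'w::ab_group_add \<Rightarrow> 'w" +
  fixes G :: "('k, 'w) tensor set"
  assumes relations_closed: "G \<subseteq> carrier (tensor_algebra s)"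
begin

abbreviation "T \<equiv> tensor_algebra s"
abbreviation "Q \<equiv> T Quot (Idl\<^bsub>T\<^esub> G)"
abbreviation "cls \<equiv> (+>\<^bsub>T\<^esub>) (Idl\<^bsub>T\<^esub> G)"

definition gen :: "'w \<Rightarrow> ('k, 'w) tensor set"
  where "gen w = cls (tvec s w)"

definition scl :: "'k \<Rightarrow> ('k, 'w) tensor set"
  where "scl c = cls (tscalar s c)"

sublocale T: ring T by (rule ring_tensor_algebra)

sublocale G: ideal "Idl\<^bsub>T\<^esub> G" T by (rule T.genideal_ideal[OF relations_closed])

sublocale cls: ring_hom_ring T Q cls by (rule G.rcos_ring_hom_ring)

lemma cls_relation:
  assumes "g \<in> G"
  shows "cls g = \<zero>\<^bsub>Q\<^esub>"
  unfolding quotient_ring_zero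
  by (rule G.a_rcos_const) (rule subsetD[OF T.genideal_self[OF relations_closed] assms])

lemma gen_closed: "gen w \<in> carrier Q" and scl_closed: "scl c \<in> carrier Q"
  by (auto simp: gen_def scl_def tvec_closed tscalar_closed)

lemma gen_add: "gen (v + w) = gen v \<oplus>\<^bsub>Q\<^esub> gen w"
  by (simp add: gen_def tvec_add tvec_closed)

lemma gen_scale: "gen (s c w) = scl c \<otimes>\<^bsub>Q\<^esub> gen w"
  by (simp add: gen_def scl_def tvec_scale tvec_closed tscalar_closed)

lemma scl_gen_commute: "scl c \<otimes>\<^bsub>Q\<^esub> gen w = gen w \<otimes>\<^bsub>Q\<^esub> scl c"
  unfolding gen_def scl_def
  by (simp add: tscalar_tvec_commute tvec_closed tscalar_closed flip: cls.hom_mult)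

lemma scl_add: "scl (c + d) = scl c \<oplus>\<^bsub>Q\<^esub> scl d"
  by (simp add: scl_def tscalar_add tscalar_closed)

lemma scl_mult: "scl (c * d) = scl c \<otimes>\<^bsub>Q\<^esub> scl d"
  by (simp add: scl_def tscalar_mult tscalar_closed)

lemma scl_one: "scl 1 = \<one>\<^bsub>Q\<^esub>"
  by (simp add: scl_def tscalar_one)

lemma quotient_induct [consumes 1, case_names scl gen add mult]:
  assumes "r \<in> carrier Q"
    and "\<And>c. P (scl c)" "\<And>w. P (gen w)"
    and add: "\<And>r r'. \<lbrakk>r \<in> carrier Q; r' \<in> carrier Q; P r; P r'\<rbrakk> \<Longrightarrow> P (r \<oplus>\<^bsub>Q\<^esub> r')"
    and mult: "\<And>r r'. \<lbrakk>r \<in> carrier Q; r' \<in> carrier Q; P r; P r'\<rbrakk> \<Longrightarrow> P (r \<otimes>\<^bsub>Q\<^esub> r')"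
  shows "P r"
proof -
  obtain t where t: "t \<in> carrier T" "r = cls t"
    using assms(1) by (rule quotient_ring_cases)
  from t(1) have "P (cls t)"
  proof (induction rule: tensor_induct)
    case (tscalar c)
    show ?case using assms(2) by (simp only: scl_def)
  next
    case (tvec w)
    show ?case using assms(3) by (simp only: gen_def)
  next
    case (add t t')
    show ?case
      unfolding cls.hom_add[OF add(1,2)] by (intro assms(4) cls.hom_closed add)
  next
    case (mult t t')
    show ?case
      unfolding cls.hom_mult[OF mult(1,2)] by (intro assms(5) cls.hom_closed mult)
  qed
  then show ?thesis using t by simp
qed

text \<open>
  The linearity of \<open>gen\<close> and the centrality of the scalars are what makes the action of a module a
  representation of \<open>W\<close>; \<open>module_of_linear_operators\<close> below goes the other way.
\<close>

lemma linear_operators_of_module: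
  assumes "left_module Q N"
  shows "linear_operators N s (\<lambda>c x. scl c \<odot>\<^bsub>N\<^esub> x) (\<lambda>w x. gen w \<odot>\<^bsub>N\<^esub> x)"
proof -
  interpret left_module Q N by fact
  have "gen w \<odot>\<^bsub>N\<^esub> (scl c \<odot>\<^bsub>N\<^esub> x) = scl c \<odot>\<^bsub>N\<^esub> (gen w \<odot>\<^bsub>N\<^esub> x)" if "x \<in> carrier N" for c w x
    using that by (simp flip: smult_assoc add: gen_closed scl_closed scl_gen_commute)
  then show ?thesis
    using M.abelian_group_axioms W.vector_space_axioms
    by (intro linear_operators.intro linear_operators_axioms.intro)
      (auto simp: gen_closed scl_closed gen_add gen_scale scl_add scl_mult scl_one
        smult_closed smult_l_distr smult_r_distr smult_assoc smult_one)
qed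

lemma submodule_generators:
  assumes N: "left_module Q N" and "H \<subseteq> carrier N" "\<zero>\<^bsub>N\<^esub> \<in> H"
    and add: "\<And>x y. x \<in> H \<Longrightarrow> y \<in> H \<Longrightarrow> x \<oplus>\<^bsub>N\<^esub> y \<in> H"
    and "\<And>c x. x \<in> H \<Longrightarrow> scl c \<odot>\<^bsub>N\<^esub> x \<in> H" "\<And>w x. x \<in> H \<Longrightarrow> gen w \<odot>\<^bsub>N\<^esub> x \<in> H"
  shows "submodule H Q N"
proof -
  interpret left_module Q N by fact
  show ?thesis
  proof (rule submoduleI_closed)
    fix r x assume "r \<in> carrier Q" and x: "x \<in> H"
    then have "\<forall>x\<in>H. r \<odot>\<^bsub>N\<^esub> x \<in> H"
      by (induction rule: quotient_induct)
        (use assms(2-) in \<open>auto simp: smult_l_distr smult_assoc subset_eq\<close>)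
    with x show "r \<odot>\<^bsub>N\<^esub> x \<in> H" by blast
  qed (use assms in auto)
qed

text \<open>
  The algebra is generated by the images of the scalars and of \<open>W\<close>.  Homomorphisms over the smash
  product and over the symmetric algebra are compared through this criterion.
\<close>

lemma module_hom_generators:
  assumes N: "left_module Q N" "left_module Q N'"
    and f: "f \<in> carrier N \<rightarrow> carrier N'"
    and add: "\<And>x y. x \<in> carrier N \<Longrightarrow> y \<in> carrier N \<Longrightarrow> f (x \<oplus>\<^bsub>N\<^esub> y) = f x \<oplus>\<^bsub>N'\<^esub> f y"
    and scl: "\<And>c x. x \<in> carrier N \<Longrightarrow> f (scl c \<odot>\<^bsub>N\<^esub> x) = scl c \<odot>\<^bsub>N'\<^esub> f x"
    and gen: "\<And>w x. x \<in> carrier N \<Longrightarrow> f (gen w \<odot>\<^bsub>N\<^esub> x) = gen w \<odot>\<^bsub>N'\<^esub> f x"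
    and "r \<in> carrier Q" "x \<in> carrier N"
  shows "f (r \<odot>\<^bsub>N\<^esub> x) = r \<odot>\<^bsub>N'\<^esub> f x"
proof -
  interpret N: left_module Q N by fact
  interpret N': left_module Q N' by fact
  have "\<forall>x\<in>carrier N. f (r \<odot>\<^bsub>N\<^esub> x) = r \<odot>\<^bsub>N'\<^esub> f x"
    using \<open>r \<in> carrier Q\<close>
  proof (induction rule: quotient_induct)
    case (add r r')
    then show ?case
      using f by (auto simp: N.smult_l_distr N'.smult_l_distr assms(4) N.smult_closed Pi_iff)
  next
    case (mult r r')
    then show ?case
      using f by (auto simp: N.smult_assoc N'.smult_assoc N.smult_closed Pi_iff)
  qed (use scl gen in auto)
  then show ?thesis using assms by blast
qed

text \<open>
  The universal property of the presented algebra in terms of modules: operators satisfying the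
  relations extend to a module structure on the same underlying group.
\<close>

lemma module_of_linear_operators:
  fixes M :: "('u, 'e) ring_scheme"
  assumes op: "linear_operators M s scal opr"
    and rel: "\<And>g x. g \<in> G \<Longrightarrow> x \<in> carrier M \<Longrightarrow>
      g \<odot>\<^bsub>linear_operators.tensor_module M scal opr\<^esub> x = \<zero>\<^bsub>M\<^esub>"
  obtains N :: "(('k, 'w) tensor set, 'u) module" where "left_module Q N" "carrier N = carrier M" "ring.zero N = ring.zero M"
    "ring.add N = ring.add M"
    "\<And>c x. x \<in> carrier M \<Longrightarrow> scl c \<odot>\<^bsub>N\<^esub> x = scal c x"
    "\<And>w x. x \<in> carrier M \<Longrightarrow> gen w \<odot>\<^bsub>N\<^esub> x = opr w x"
proof -
  interpret linear_operators M s scal opr by fact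
  interpret tm: left_module T tensor_module by (rule left_module_tensor)
  have null: "r \<odot>\<^bsub>tensor_module\<^esub> x = \<zero>\<^bsub>tensor_module\<^esub>"
    if "r \<in> Idl\<^bsub>T\<^esub> G" "x \<in> carrier tensor_module" for r x
    using tm.genideal_annihilates[OF relations_closed _ that] rel by simp
  have sm: "cls r \<odot>\<^bsub>quotient_module tensor_module\<^esub> x = r \<odot>\<^bsub>tensor_module\<^esub> x"
    if "r \<in> carrier T" "x \<in> carrier M" for r x
    by (rule quotient_module_smult[OF left_module_tensor G.ideal_axioms null]) (use that in simp_all)
  show ?thesis
  proof (rule that[of "quotient_module tensor_module"])
    show "left_module Q (quotient_module tensor_module)"
      by (rule left_module_quotient[OF left_module_tensor G.ideal_axioms null])
  qed (auto simp: gen_def scl_def sm tvec_closed tscalar_closed tvec_smult tscalar_smult)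
qed

end

section \<open>Bilinear maps on the tensor square\<close>

lemma bilinear_mapD:
  assumes "bilinear_map s1 s2 s3 f"
  shows "f (x + x') y = f x y + f x' y" "f x (y + y') = f x y + f x y'"
    and "f (s1 c x) y = s3 c (f x y)" "f x (s2 c y) = s3 c (f x y)"
    and "vector_space s1" "vector_space s2" "vector_space s3"
  using assms by (auto simp: bilinear_map_def Vector_Spaces.linear_iff)

lemma bilinear_map_zero:
  assumes "bilinear_map s1 s2 s3 f"
  shows "f 0 y = 0" "f x 0 = 0"
  using bilinear_mapD(1)[OF assms, of 0 0 y] bilinear_mapD(2)[OF assms, of x 0 0] by simp_all

text \<open>
  This lets a type of class \<open>ab_group_add\<close> carry linear operators in the sense of
  \<open>linear_operators\<close>.
\<close>

definition additive_group :: "'z::ab_group_add ring"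
  where "additive_group =
    \<lparr>carrier = UNIV, monoid.mult = undefined, one = undefined, ring.zero = 0, ring.add = (+)\<rparr>"

lemma additive_group_simps [simp]:
  "carrier additive_group = UNIV" "\<zero>\<^bsub>additive_group\<^esub> = 0" "x \<oplus>\<^bsub>additive_group\<^esub> y = x + y"
  by (simp_all add: additive_group_def)

lemma abelian_group_additive_group: "abelian_group additive_group"
  by (rule abelian_groupI) (auto simp: algebra_simps intro: exI[of _ "- x" for x])

text \<open>
  A formula in Sweedler notation does not depend on the presentation of the tensor.  The bilinear map
  \<open>B\<close> is read off from a module over the tensor algebra: \<open>W\<close> acts on \<open>K \<oplus> W \<oplus> Z\<close> by
  \<open>w (r, x, z) = (0, r w, B w x)\<close>, so that \<open>x \<otimes> y\<close> sends \<open>(1, 0, 0)\<close> to \<open>(0, 0, B x y)\<close>.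
\<close>

lemma tensor2_bilinear_eq:
  fixes s :: "'k::field \<Rightarrow> 'w::ab_group_add \<Rightarrow> 'w" and B :: "'w \<Rightarrow> 'w \<Rightarrow> 'z::ab_group_add"
  assumes B: "bilinear_map s s sZ B" and eq: "tensor2 s ps = tensor2 s qs"
  shows "(\<Sum>(x, y)\<leftarrow>ps. B x y) = (\<Sum>(x, y)\<leftarrow>qs. B x y)"
proof -
  interpret W: vector_space s using bilinear_mapD(5)[OF B] .
  interpret Z: vector_space sZ using bilinear_mapD(7)[OF B] .
  let ?M = "additive_group :: ('k \<times> 'w \<times> 'z) ring"
  define scal :: "'k \<Rightarrow> 'k \<times> 'w \<times> 'z \<Rightarrow> 'k \<times> 'w \<times> 'z"
    where "scal = (\<lambda>c (r, x, z). (c * r, s c x, sZ c z))"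
  define opr :: "'w \<Rightarrow> 'k \<times> 'w \<times> 'z \<Rightarrow> 'k \<times> 'w \<times> 'z"
    where "opr = (\<lambda>w (r, x, z). (0, s r w, B w x))"
  interpret L: linear_operators ?M s scal opr
    by (intro linear_operators.intro linear_operators_axioms.intro abelian_group_additive_group
          W.vector_space_axioms)
      (auto simp: scal_def opr_def bilinear_mapD[OF B] bilinear_map_zero[OF B] algebra_simps
        W.scale_right_distrib W.scale_left_distrib Z.scale_right_distrib Z.scale_left_distrib)
  interpret T: left_module "tensor_algebra s" L.tensor_module by (rule L.left_module_tensor)
  have [simp]: "list_sum L.tensor_module xs = sum_list xs" for xs
    by (induction xs) (auto simp: list_sum_def)
  have "tensor2 s ps \<odot>\<^bsub>L.tensor_module\<^esub> (1, 0, 0) = (0, 0, \<Sum>(x, y)\<leftarrow>ps. B x y)" for ps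
  proof -
    have "tensor2 s ps \<odot>\<^bsub>L.tensor_module\<^esub> (1, 0, 0) =
        (\<Sum>t\<leftarrow>map (\<lambda>(x, y). tvec s x \<otimes>\<^bsub>tensor_algebra s\<^esub> tvec s y) ps. t \<odot>\<^bsub>L.tensor_module\<^esub> (1, 0, 0))"
      unfolding tensor2_def
      by (subst T.smult_list_sum[THEN conjunct2]) (auto simp: tvec_closed)
    also have "\<dots> = (\<Sum>(x, y)\<leftarrow>ps. (0, 0, B x y))"
      by (auto simp: comp_def case_prod_beta T.smult_assoc tvec_closed L.tvec_smult
          intro!: arg_cong[of _ _ sum_list]) (simp add: opr_def)
    also have "\<dots> = (0, 0, \<Sum>(x, y)\<leftarrow>ps. B x y)"
      by (induction ps) (auto simp: zero_prod_def)
    finally show ?thesis .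
  qed
  from this[of ps] this[of qs] eq show ?thesis by simp
qed

section \<open>The augmentation and the powers of the maximal ideal\<close>

lemma ideal_power_0: "ideal_power I 0 = UNIV"
  by (simp add: ideal_power_def ideals_set_def)

lemma ideal_power_Suc: "ideal_power I (Suc k) = ideal_power I k \<cdot>\<^bsub>ring_of_type_algebra\<^esub> I"
  by (simp add: ideal_power_def ideals_set_def)

locale nilpotent_augmentation = cocommutative_algebra s \<Delta>
  for s :: "'k::field \<Rightarrow> 'a::ring_1 \<Rightarrow> 'a" and \<Delta> :: "'a \<Rightarrow> ('k, 'a) tensor" +
  fixes \<mm> :: "'a set"
  assumes ideal_m: "ideal \<mm> ring_of_type_algebra"
    and nilpotent: "\<exists>n. ideal_power \<mm> n = {0}"
    and decomp: "\<exists>!p. fst p \<in> \<mm> \<and> a = fst p + s (snd p) 1"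
    and cop_m: "a \<in> \<mm> \<Longrightarrow> \<exists>ps. set ps \<subseteq> \<mm> \<times> \<mm> \<and> \<Delta> a = tensor2 s ps"
begin

sublocale A: ring "ring_of_type_algebra :: 'a ring" by (rule ring_type_algebra)

sublocale m: ideal \<mm> ring_of_type_algebra by (rule ideal_m)

lemma m_closed: "0 \<in> \<mm>" "x \<in> \<mm> \<Longrightarrow> y \<in> \<mm> \<Longrightarrow> x + y \<in> \<mm>" "x \<in> \<mm> \<Longrightarrow> a * x \<in> \<mm>" "x \<in> \<mm> \<Longrightarrow> x * a \<in> \<mm>"
  using m.a_closed m.I_l_closed m.I_r_closed m.zero_closed by auto

lemma m_scale: "x \<in> \<mm> \<Longrightarrow> s c x \<in> \<mm>"
  using m_closed(3)[of x "s c 1"] by (simp flip: scale_mult_left)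

definition aug :: "'a \<Rightarrow> 'k"
  where "aug a = snd (THE p. fst p \<in> \<mm> \<and> a = fst p + s (snd p) 1)"

lemma aug_unique: "x \<in> \<mm> \<Longrightarrow> aug (x + s c 1) = c"
  using the1_equality[OF decomp, of "(x, c)" "x + s c 1"] by (simp add: aug_def)

lemma aug_cases:
  obtains x where "x \<in> \<mm>" "a = x + s (aug a) 1"
  using theI'[OF decomp, of a] unfolding aug_def by blast

lemma aug_m: "a \<in> \<mm> \<longleftrightarrow> aug a = 0"
  using aug_unique[of a 0] aug_cases[of a] by fastforce

lemma aug_add: "aug (a + b) = aug a + aug b"
proof -
  obtain x y where "x \<in> \<mm>" "a = x + s (aug a) 1" "y \<in> \<mm>" "b = y + s (aug b) 1"
    by (metis aug_cases)
  then show ?thesis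
    using aug_unique[of "x + y" "aug a + aug b"]
    by (metis (no_types, lifting) ab_semigroup_add_class.add_ac(1) add.left_commute m_closed(2) scale_left_distrib)
qed

lemma aug_scale: "aug (s c a) = c * aug a"
proof -
  obtain x where "x \<in> \<mm>" "a = x + s (aug a) 1" by (rule aug_cases)
  then show ?thesis
    using aug_unique[of "s c x" "c * aug a"] m_scale[of x c] by (metis scale_right_distrib scale_scale)
qed

lemma aug_one: "aug 1 = 1"
  using aug_unique[of 0 1] m_closed(1) by simp

lemma aug_mult: "aug (a * b) = aug a * aug b"
proof -
  obtain x where x: "x \<in> \<mm>" "a = x + s (aug a) 1" by (rule aug_cases)
  then have "a * b = x * b + s (aug a) b"
    by (metis distrib_right mult_1 scale_mult_left)
  moreover have "x * b \<in> \<mm>" using x(1) by (rule m_closed)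
  ultimately show ?thesis by (simp add: aug_add aug_scale aug_m)
qed

text \<open>
  Since \<open>a - \<epsilon>(a) 1\<close> lies in \<open>\<mm>\<close>, the coproduct of \<open>a\<close> is \<open>\<epsilon>(a) 1 \<otimes> 1\<close> up to a tensor with both
  factors in \<open>\<mm>\<close>.
\<close>

lemma cop_presentation:
  obtains ps where "set ps \<subseteq> \<mm> \<times> \<mm>" "\<Delta> a = tensor2 s (ps @ [(s (aug a) 1, 1)])"
proof -
  obtain x where x: "x \<in> \<mm>" "a = x + s (aug a) 1" by (rule aug_cases)
  obtain ps where ps: "set ps \<subseteq> \<mm> \<times> \<mm>" "\<Delta> x = tensor2 s ps" using cop_m[OF x(1)] by blast
  interpret T: ring "tensor_algebra s" by (rule ring_tensor_algebra)
  have closed: "tvec s u \<otimes>\<^bsub>tensor_algebra s\<^esub> tvec s v \<in> carrier (tensor_algebra s)" for u v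
    by (simp add: tvec_closed)
  have "\<Delta> (s (aug a) 1) = tensor2 s [(s (aug a) 1, 1)]"
    unfolding cop_scale cop_one tensor2_def list_sum_def
    by (simp add: tvec_scale tvec_closed tscalar_closed T.m_assoc)
  moreover have "tensor2 s (ps @ qs) = tensor2 s ps \<oplus>\<^bsub>tensor_algebra s\<^esub> tensor2 s qs" for ps qs
  proof -
    have "tensor2 s ps \<in> carrier (tensor_algebra s)" for ps
      unfolding tensor2_def by (rule list_sum_closed[OF T.abelian_monoid_axioms]) (auto intro: closed)
    then show ?thesis
      by (induction ps) (auto simp: tensor2_def list_sum_def closed T.a_assoc)
  qed
  ultimately have "\<Delta> a = tensor2 s (ps @ [(s (aug a) 1, 1)])"
    using ps(2) x(2) cop_add by metis
  with ps(1) show ?thesis by (rule that)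
qed

lemma ideal_power_ideal: "ideal (ideal_power \<mm> k) ring_of_type_algebra"
  by (induction k)
    (auto simp: ideal_power_0 ideal_power_Suc intro: A.oneideal[simplified] A.ideal_prod_is_ideal ideal_m)

lemma ideal_power_closed:
  "0 \<in> ideal_power \<mm> k" "x \<in> ideal_power \<mm> k \<Longrightarrow> y \<in> ideal_power \<mm> k \<Longrightarrow> x + y \<in> ideal_power \<mm> k"
proof -
  interpret I: ideal "ideal_power \<mm> k" ring_of_type_algebra by (rule ideal_power_ideal)
  show "0 \<in> ideal_power \<mm> k" "x \<in> ideal_power \<mm> k \<Longrightarrow> y \<in> ideal_power \<mm> k \<Longrightarrow> x + y \<in> ideal_power \<mm> k"
    using I.zero_closed I.a_closed by auto
qed

lemma ideal_power_mult: "a \<in> ideal_power \<mm> k \<Longrightarrow> x \<in> \<mm> \<Longrightarrow> a * x \<in> ideal_power \<mm> (Suc k)"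
  using ideal_prod.prod[of a _ x \<mm> ring_of_type_algebra] by (simp add: ideal_power_Suc)

lemma ideal_power_1: "ideal_power \<mm> 1 = \<mm>"
proof
  show "ideal_power \<mm> 1 \<subseteq> \<mm>"
    using A.ideal_prod_inter[OF A.oneideal ideal_m] by (auto simp: ideal_power_0 ideal_power_Suc)
  show "\<mm> \<subseteq> ideal_power \<mm> 1"
    using ideal_power_mult[of 1 0] by (auto simp: ideal_power_0)
qed

text \<open>
  Here \<open>k\<close> is the exponent of the last nonzero power of \<open>\<mm>\<close>; it exists because \<open>\<mm>\<^sup>0 = A\<close> is nonzero
  and some power is zero.
\<close>

lemma socle_element:
  "\<exists>k. \<exists>a\<in>ideal_power \<mm> k. a \<noteq> 0 \<and> (\<forall>b\<in>ideal_power \<mm> k. \<forall>x\<in>\<mm>. b * x = 0)"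
proof -
  define n where "n = (LEAST n. ideal_power \<mm> n = {0})"
  have n: "ideal_power \<mm> n = {0}" unfolding n_def using nilpotent by (rule LeastI_ex)
  have "n \<noteq> 0" using n zero_neq_one by (metis UNIV_I ideal_power_0 singletonD)
  then obtain k where k: "n = Suc k" by (cases n) auto
  then have "ideal_power \<mm> k \<noteq> {0}" using not_less_Least[of k "\<lambda>n. ideal_power \<mm> n = {0}"] by (simp add: n_def)
  then obtain a where "a \<in> ideal_power \<mm> k" "a \<noteq> 0" using ideal_power_closed(1)[of k] by blast
  moreover have "b * x = 0" if "b \<in> ideal_power \<mm> k" "x \<in> \<mm>" for b x
    using ideal_power_mult[OF that] n k by simp
  ultimately show ?thesis by blast
qed

end

section \<open>The action of \<open>\<lambda>\<close> on the powers of the maximal ideal\<close>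

locale deformation_data = nilpotent_augmentation sA \<Delta> \<mm> + algebra_module sA sV act +
  smash_data sA \<Delta> sV act lam kap
  for sA :: "'k::field \<Rightarrow> 'a::ring_1 \<Rightarrow> 'a" and \<Delta> :: "'a \<Rightarrow> ('k, 'a) tensor" and \<mm> :: "'a set"
    and sV :: "'k \<Rightarrow> 'v::ab_group_add \<Rightarrow> 'v" and act :: "'a \<Rightarrow> 'v \<Rightarrow> 'v"
    and lam :: "'a \<Rightarrow> 'v \<Rightarrow> 'a" and kap :: "'v \<Rightarrow> 'v \<Rightarrow> 'v \<times> 'a" +
  assumes lam_bilinear: "bilinear_map sA sV sA lam"
begin

text \<open>
  The product rule for \<open>\<lambda>\<close>.  It is what results from comparing \<open>(a a') v\<close> with \<open>a (a' v)\<close> by means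
  of the commutation relation of the smash product.
\<close>

definition twisted_derivation :: bool
  where "twisted_derivation \<longleftrightarrow> (\<forall>a a' v ps. \<Delta> a' = tensor2 sA ps \<longrightarrow>
    lam (a * a') v = a * lam a' v + (\<Sum>(x, y)\<leftarrow>ps. lam a (act x v) * y))"

text \<open>
  The induction runs over \<open>k\<close>, with \<open>j\<close> arbitrary: the induction hypothesis is used both for the last
  nonzero power of \<open>\<mm>\<close>, to get \<open>\<lambda>(\<mm>, v) \<subseteq> \<mm>\<close>, and for \<open>j - 1\<close>, to get \<open>\<lambda>(\<mm>\<^sup>j, v) \<subseteq> \<mm>\<^sup>j\<close>.
\<close>

lemma lam_preserves_powers_of_level:
  assumes twist: "twisted_derivation"
    and "\<forall>a\<in>ideal_power \<mm> k. act a v = 0" and "a \<in> ideal_power \<mm> j"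
  shows "lam a v \<in> ideal_power \<mm> j"
  using assms(2,3)
proof (induction k arbitrary: v a j)
  case 0
  have "v = 0" using 0(1) act_one[of v] by (auto simp: ideal_power_0)
  then show ?case by (simp add: bilinear_map_zero[OF lam_bilinear] ideal_power_closed)
next
  case (Suc k)
  have sum_mem: "(\<Sum>(x, y)\<leftarrow>ps. lam b (act x v) * y) \<in> ideal_power \<mm> (Suc i)"
    if "b \<in> ideal_power \<mm> i" "set ps \<subseteq> \<mm> \<times> \<mm>" for b i ps
    using that(2)
  proof (induction ps)
    case (Cons p ps)
    have "\<forall>c\<in>ideal_power \<mm> k. act c (act (fst p) v) = 0"
      using Suc.prems(1) Cons.prems ideal_power_mult by (auto simp flip: act_mult)
    then have "lam b (act (fst p) v) * snd p \<in> ideal_power \<mm> (Suc i)"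
      using Suc.IH that(1) Cons.prems by (intro ideal_power_mult) auto
    then show ?case using Cons by (auto intro: ideal_power_closed)
  qed (simp add: ideal_power_closed)
  have lam_m: "lam x v \<in> \<mm>" if x: "x \<in> \<mm>" for x
  proof -
    obtain n b where b: "b \<in> ideal_power \<mm> n" "b \<noteq> 0"
        "\<And>c y. c \<in> ideal_power \<mm> n \<Longrightarrow> y \<in> \<mm> \<Longrightarrow> c * y = 0"
      using socle_element by auto
    obtain ps where ps: "set ps \<subseteq> \<mm> \<times> \<mm>" "\<Delta> x = tensor2 sA ps" using cop_m[OF x] by blast
    have "lam b (act y v) * z = 0" if "(y, z) \<in> set ps" for y z
    proof -
      have "\<forall>c\<in>ideal_power \<mm> k. act c (act y v) = 0"
        using Suc.prems(1) ps that ideal_power_mult by (auto simp flip: act_mult)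
      then show ?thesis using Suc.IH b ps that by auto
    qed
    then have "(\<Sum>(y, z)\<leftarrow>ps. lam b (act y v) * z) = 0"
      by (induction ps) auto
    moreover have "lam (b * x) v = 0"
      using b x by (simp add: bilinear_map_zero[OF lam_bilinear])
    ultimately have "b * lam x v = 0"
      using twist ps(2) unfolding twisted_derivation_def by (metis add.right_neutral)
    moreover obtain p where "p \<in> \<mm>" "lam x v = p + sA (aug (lam x v)) 1" by (rule aug_cases)
    \<comment> \<open>only the unit part of \<open>\<lambda>(x, v)\<close> survives the multiplication by \<open>b\<close>\<close>
    with b have "b * lam x v = sA (aug (lam x v)) b"
      by (metis add_0 distrib_left mult.right_neutral scale_mult_right)
    ultimately show ?thesis using b(2) by (simp add: aug_m)
  qed
  show ?case
  proof (cases j)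
    case 0
    then show ?thesis by (simp add: ideal_power_0)
  next
    case (Suc i)
    from \<open>a \<in> ideal_power \<mm> j\<close> have "a \<in> ideal_power \<mm> i \<cdot>\<^bsub>ring_of_type_algebra\<^esub> \<mm>"
      by (simp add: Suc ideal_power_Suc)
    then have "lam a v \<in> ideal_power \<mm> (Suc i)"
    proof (induction rule: ideal_prod.induct)
      case (prod b x)
      obtain ps where ps: "set ps \<subseteq> \<mm> \<times> \<mm>" "\<Delta> x = tensor2 sA ps" using cop_m[OF prod(2)] by blast
      have eq: "lam (b * x) v = b * lam x v + (\<Sum>(x, y)\<leftarrow>ps. lam b (act x v) * y)"
        using twist ps(2) unfolding twisted_derivation_def by blast
      show ?case
        unfolding type_algebra_simps eq
        by (intro ideal_power_closed(2) ideal_power_mult sum_mem lam_m prod ps(1))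
    next
      case (sum b c)
      then show ?case by (simp add: bilinear_mapD[OF lam_bilinear] ideal_power_closed)
    qed
    then show ?thesis using Suc by simp
  qed
qed

lemma lam_preserves_powers:
  assumes "twisted_derivation" "a \<in> ideal_power \<mm> j"
  shows "lam a v \<in> ideal_power \<mm> j"
proof -
  obtain n where "ideal_power \<mm> n = {0}" using nilpotent by blast
  then show ?thesis
    using assms by (intro lam_preserves_powers_of_level[of n]) (auto simp: bilinear_map_zero[OF act_bilinear])
qed

lemma lam_one:
  assumes "twisted_derivation"
  shows "lam 1 v = 0"
proof -
  have "lam (1 * 1) v = 1 * lam 1 v + (\<Sum>(x, y)\<leftarrow>[(1, 1)]. lam 1 (act x v) * y)"
    using assms cop_one unfolding twisted_derivation_def by blast
  then show ?thesis by (simp add: act_one)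
qed

end

section \<open>The defining relations as identities between operators\<close>

text \<open>
  The generating set in the definition of the symmetric algebra, named so that it can be used as the
  relations of a presented algebra.
\<close>

definition sym_relations :: "('k::field \<Rightarrow> 'v::ab_group_add \<Rightarrow> 'v) \<Rightarrow> ('k, 'v) tensor set"
  where "sym_relations sV =
    {tvec sV v \<otimes>\<^bsub>tensor_algebra sV\<^esub> tvec sV w
       \<ominus>\<^bsub>tensor_algebra sV\<^esub> tvec sV w \<otimes>\<^bsub>tensor_algebra sV\<^esub> tvec sV v | v w. True}"

lemma vector_space_scale_prod:
  assumes "vector_space sV" "vector_space sA"
  shows "vector_space (scale_prod sV sA)"
proof -
  interpret V: vector_space sV by fact
  interpret A: vector_space sA by fact
  show ?thesis
    by unfold_locales
      (auto simp: scale_prod_def V.scale_right_distrib A.scale_right_distrib V.scale_left_distrib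
        A.scale_left_distrib)
qed

lemma smash_relations_closed:
  "smash_relations sA \<Delta> sV act lam kap \<subseteq> carrier (tensor_algebra (scale_prod sV sA))"
proof -
  interpret T: ring "tensor_algebra (scale_prod sV sA)" by (rule ring_tensor_algebra)
  have sum: "list_sum (tensor_algebra (scale_prod sV sA))
      (map (\<lambda>(x, y). tvec (scale_prod sV sA) (act x v, 0) \<otimes>\<^bsub>tensor_algebra (scale_prod sV sA)\<^esub>
        tvec (scale_prod sV sA) (0, y)) ps) \<in> carrier (tensor_algebra (scale_prod sV sA))" for v ps
    by (rule list_sum_closed[OF T.abelian_monoid_axioms]) (auto simp: tvec_closed)
  show ?thesis
    unfolding smash_relations_def Let_def by (auto intro!: sum tvec_closed T.minus_closed T.m_closed T.one_closed)
qed

lemma sym_relations_closed: "sym_relations sV \<subseteq> carrier (tensor_algebra sV)"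
proof -
  interpret T: ring "tensor_algebra sV" by (rule ring_tensor_algebra)
  show ?thesis
    unfolding sym_relations_def by (auto intro!: tvec_closed T.minus_closed T.m_closed)
qed

lemma sym_relations_annihilate_iff:
  assumes "left_module (tensor_algebra sV) P" "x \<in> carrier P"
  shows "(\<forall>g\<in>sym_relations sV. g \<odot>\<^bsub>P\<^esub> x = \<zero>\<^bsub>P\<^esub>) \<longleftrightarrow>
    (\<forall>v w. tvec sV v \<odot>\<^bsub>P\<^esub> (tvec sV w \<odot>\<^bsub>P\<^esub> x) = tvec sV w \<odot>\<^bsub>P\<^esub> (tvec sV v \<odot>\<^bsub>P\<^esub> x))"
proof -
  interpret P: left_module "tensor_algebra sV" P by fact
  have "(tvec sV v \<otimes>\<^bsub>tensor_algebra sV\<^esub> tvec sV w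
       \<ominus>\<^bsub>tensor_algebra sV\<^esub> tvec sV w \<otimes>\<^bsub>tensor_algebra sV\<^esub> tvec sV v) \<odot>\<^bsub>P\<^esub> x = \<zero>\<^bsub>P\<^esub> \<longleftrightarrow>
     tvec sV v \<odot>\<^bsub>P\<^esub> (tvec sV w \<odot>\<^bsub>P\<^esub> x) = tvec sV w \<odot>\<^bsub>P\<^esub> (tvec sV v \<odot>\<^bsub>P\<^esub> x)" for v w
    using assms(2)
    by (simp add: P.smult_l_diff P.smult_assoc P.smult_closed tvec_closed P.M.minus_eq_zero_iff)
  then show ?thesis
    unfolding sym_relations_def by blast
qed

text \<open>
  On a module over the tensor algebra, the vanishing of the defining relations of the smash product
  is a set of identities between the operators of \<open>V\<close> and \<open>A\<close>.  Read from left to right this gives the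
  identities that hold in every module over the smash product; read from right to left it is the
  condition for inflating a module.
\<close>

lemma smash_relations_annihilate_iff:
  fixes sA :: "'k::field \<Rightarrow> 'a::ring_1 \<Rightarrow> 'a" and sV :: "'k \<Rightarrow> 'v::ab_group_add \<Rightarrow> 'v"
  defines "iV \<equiv> \<lambda>v. tvec (scale_prod sV sA) (v, 0)" and "iA \<equiv> \<lambda>a. tvec (scale_prod sV sA) (0, a)"
  assumes "left_module (tensor_algebra (scale_prod sV sA)) P" and x: "x \<in> carrier P"
  shows "(\<forall>g\<in>smash_relations sA \<Delta> sV act lam kap. g \<odot>\<^bsub>P\<^esub> x = \<zero>\<^bsub>P\<^esub>) \<longleftrightarrow>
    (\<forall>a b. iA a \<odot>\<^bsub>P\<^esub> (iA b \<odot>\<^bsub>P\<^esub> x) = iA (a * b) \<odot>\<^bsub>P\<^esub> x) \<and>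
    iA 1 \<odot>\<^bsub>P\<^esub> x = x \<and>
    (\<forall>a v ps. \<Delta> a = tensor2 sA ps \<longrightarrow> iA a \<odot>\<^bsub>P\<^esub> (iV v \<odot>\<^bsub>P\<^esub> x) =
      list_sum P (map (\<lambda>(y, z). iV (act y v) \<odot>\<^bsub>P\<^esub> (iA z \<odot>\<^bsub>P\<^esub> x)) ps) \<oplus>\<^bsub>P\<^esub> iA (lam a v) \<odot>\<^bsub>P\<^esub> x) \<and>
    (\<forall>v w. iV v \<odot>\<^bsub>P\<^esub> (iV w \<odot>\<^bsub>P\<^esub> x) =
      iV w \<odot>\<^bsub>P\<^esub> (iV v \<odot>\<^bsub>P\<^esub> x) \<oplus>\<^bsub>P\<^esub> tvec (scale_prod sV sA) (kap v w) \<odot>\<^bsub>P\<^esub> x)"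
    (is "?L \<longleftrightarrow> ?R")
proof -
  let ?T = "tensor_algebra (scale_prod sV sA)"
  interpret P: left_module ?T P by fact
  note c = tvec_closed[of "scale_prod sV sA"]
  have "(iA a \<otimes>\<^bsub>?T\<^esub> iA b \<ominus>\<^bsub>?T\<^esub> iA (a * b)) \<odot>\<^bsub>P\<^esub> x = \<zero>\<^bsub>P\<^esub> \<longleftrightarrow>
      iA a \<odot>\<^bsub>P\<^esub> (iA b \<odot>\<^bsub>P\<^esub> x) = iA (a * b) \<odot>\<^bsub>P\<^esub> x" for a b
    using x by (simp add: iA_def P.smult_l_diff P.smult_assoc P.smult_closed c P.M.minus_eq_zero_iff)
  moreover have "(iA 1 \<ominus>\<^bsub>?T\<^esub> \<one>\<^bsub>?T\<^esub>) \<odot>\<^bsub>P\<^esub> x = \<zero>\<^bsub>P\<^esub> \<longleftrightarrow> iA 1 \<odot>\<^bsub>P\<^esub> x = x"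
    using x by (simp add: iA_def P.smult_l_diff P.smult_one P.smult_closed c P.M.minus_eq_zero_iff)
  moreover have "(iA a \<otimes>\<^bsub>?T\<^esub> iV v \<ominus>\<^bsub>?T\<^esub> list_sum ?T (map (\<lambda>(y, z). iV (act y v) \<otimes>\<^bsub>?T\<^esub> iA z) ps)
        \<ominus>\<^bsub>?T\<^esub> iA (lam a v)) \<odot>\<^bsub>P\<^esub> x = \<zero>\<^bsub>P\<^esub> \<longleftrightarrow>
      iA a \<odot>\<^bsub>P\<^esub> (iV v \<odot>\<^bsub>P\<^esub> x) =
      list_sum P (map (\<lambda>(y, z). iV (act y v) \<odot>\<^bsub>P\<^esub> (iA z \<odot>\<^bsub>P\<^esub> x)) ps) \<oplus>\<^bsub>P\<^esub> iA (lam a v) \<odot>\<^bsub>P\<^esub> x"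
    for a v ps
  proof -
    let ?rs = "map (\<lambda>(y, z). iV (act y v) \<otimes>\<^bsub>?T\<^esub> iA z) ps"
    have rs: "set ?rs \<subseteq> carrier ?T" by (auto simp: iA_def iV_def c)
    have "map (\<lambda>r. r \<odot>\<^bsub>P\<^esub> x) ?rs = map (\<lambda>(y, z). iV (act y v) \<odot>\<^bsub>P\<^esub> (iA z \<odot>\<^bsub>P\<^esub> x)) ps"
      using x by (auto simp: iA_def iV_def c P.smult_assoc)
    then have
      "list_sum ?T ?rs \<in> carrier ?T"
      "list_sum ?T ?rs \<odot>\<^bsub>P\<^esub> x = list_sum P (map (\<lambda>(y, z). iV (act y v) \<odot>\<^bsub>P\<^esub> (iA z \<odot>\<^bsub>P\<^esub> x)) ps)"
      using P.smult_list_sum[OF rs x] by metis+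
    then show ?thesis
      using x P.smult_closed[of "list_sum ?T ?rs" x]
      by (simp add: iA_def iV_def P.smult_l_diff P.smult_assoc P.smult_closed c
          P.M.minus_minus_eq_zero_iff)
  qed
  moreover have "(iV v \<otimes>\<^bsub>?T\<^esub> iV w \<ominus>\<^bsub>?T\<^esub> iV w \<otimes>\<^bsub>?T\<^esub> iV v \<ominus>\<^bsub>?T\<^esub> tvec (scale_prod sV sA) (kap v w)) \<odot>\<^bsub>P\<^esub> x = \<zero>\<^bsub>P\<^esub> \<longleftrightarrow>
      iV v \<odot>\<^bsub>P\<^esub> (iV w \<odot>\<^bsub>P\<^esub> x) =
      iV w \<odot>\<^bsub>P\<^esub> (iV v \<odot>\<^bsub>P\<^esub> x) \<oplus>\<^bsub>P\<^esub> tvec (scale_prod sV sA) (kap v w) \<odot>\<^bsub>P\<^esub> x" for v w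
    using x by (simp add: iV_def P.smult_l_diff P.smult_assoc P.smult_closed c
        P.M.minus_minus_eq_zero_iff)
  moreover have "?L \<longleftrightarrow>
      (\<forall>a b. (iA a \<otimes>\<^bsub>?T\<^esub> iA b \<ominus>\<^bsub>?T\<^esub> iA (a * b)) \<odot>\<^bsub>P\<^esub> x = \<zero>\<^bsub>P\<^esub>) \<and>
      (iA 1 \<ominus>\<^bsub>?T\<^esub> \<one>\<^bsub>?T\<^esub>) \<odot>\<^bsub>P\<^esub> x = \<zero>\<^bsub>P\<^esub> \<and>
      (\<forall>a v ps. \<Delta> a = tensor2 sA ps \<longrightarrow>
        (iA a \<otimes>\<^bsub>?T\<^esub> iV v \<ominus>\<^bsub>?T\<^esub> list_sum ?T (map (\<lambda>(y, z). iV (act y v) \<otimes>\<^bsub>?T\<^esub> iA z) ps)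
        \<ominus>\<^bsub>?T\<^esub> iA (lam a v)) \<odot>\<^bsub>P\<^esub> x = \<zero>\<^bsub>P\<^esub>) \<and>
      (\<forall>v w. (iV v \<otimes>\<^bsub>?T\<^esub> iV w \<ominus>\<^bsub>?T\<^esub> iV w \<otimes>\<^bsub>?T\<^esub> iV v \<ominus>\<^bsub>?T\<^esub> tvec (scale_prod sV sA) (kap v w)) \<odot>\<^bsub>P\<^esub> x = \<zero>\<^bsub>P\<^esub>)"
    unfolding smash_relations_def Let_def iV_def iA_def by fast
  ultimately show ?thesis by simp
qed

context deformation_data
begin

abbreviation "sW \<equiv> scale_prod sV sA"

sublocale H: tensor_quotient sW "smash_relations sA \<Delta> sV act lam kap"
  by (intro tensor_quotient.intro tensor_quotient_axioms.intro vector_space_scale_prod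
      smash_relations_closed V.vector_space_axioms vector_space_axioms)

sublocale S: tensor_quotient sV "sym_relations sV"
  by (intro tensor_quotient.intro tensor_quotient_axioms.intro
      sym_relations_closed V.vector_space_axioms)

lemma smash_eqs:
  "smash_algebra = H.Q" "smash_V v = H.gen (v, 0)" "smash_A a = H.gen (0, a)" "smash_scalar c = H.scl c"
  by (simp_all only: smash_algebra_def smash_ideal_def smash_V_def smash_A_def smash_scalar_def
      H.gen_def H.scl_def)

lemma sym_eqs:
  "sym_algebra sV = S.Q" "sym_V sV v = S.gen v" "sym_scalar sV c = S.scl c"
proof -
  have ideal: "sym_ideal sV = Idl\<^bsub>S.T\<^esub> (sym_relations sV)"
    by (simp only: sym_ideal_def sym_relations_def)
  show "sym_algebra sV = S.Q" "sym_V sV v = S.gen v" "sym_scalar sV c = S.scl c"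
    by (simp_all only: sym_algebra_def ideal sym_V_def sym_scalar_def S.gen_def S.scl_def)
qed

end

section \<open>Restriction to \<open>V\<close> and inflation\<close>

context deformation_data
begin

lemma smash_closed:
  "smash_V v \<in> carrier smash_algebra" "smash_A a \<in> carrier smash_algebra"
  "smash_scalar c \<in> carrier smash_algebra"
  by (simp_all add: smash_eqs H.gen_closed H.scl_closed)

lemma sym_closed: "sym_V sV v \<in> carrier (sym_algebra sV)" "sym_scalar sV c \<in> carrier (sym_algebra sV)"
  by (simp_all add: sym_eqs S.gen_closed S.scl_closed)

lemma smash_module_gen:
  assumes "left_module smash_algebra M" "x \<in> carrier M"
  shows "H.gen (v, a) \<odot>\<^bsub>M\<^esub> x = smash_V v \<odot>\<^bsub>M\<^esub> x \<oplus>\<^bsub>M\<^esub> smash_A a \<odot>\<^bsub>M\<^esub> x"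
proof -
  interpret M: left_module smash_algebra M by fact
  have "H.gen (v, a) = smash_V v \<oplus>\<^bsub>smash_algebra\<^esub> smash_A a"
    using H.gen_add[of "(v, 0)" "(0, a)"] by (simp add: smash_eqs)
  then show ?thesis using assms(2) by (simp add: M.smult_l_distr smash_closed)
qed

lemma smash_module_relations:
  fixes M :: "(('k, 'v, 'a) smash, 'u) module"
  assumes M: "left_module smash_algebra M" and x: "x \<in> carrier M"
  shows "smash_A a \<odot>\<^bsub>M\<^esub> (smash_A b \<odot>\<^bsub>M\<^esub> x) = smash_A (a * b) \<odot>\<^bsub>M\<^esub> x"
    and "smash_A 1 \<odot>\<^bsub>M\<^esub> x = x"
    and "\<Delta> a = tensor2 sA ps \<Longrightarrow> smash_A a \<odot>\<^bsub>M\<^esub> (smash_V v \<odot>\<^bsub>M\<^esub> x) =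
      list_sum M (map (\<lambda>(y, z). smash_V (act y v) \<odot>\<^bsub>M\<^esub> (smash_A z \<odot>\<^bsub>M\<^esub> x)) ps)
        \<oplus>\<^bsub>M\<^esub> smash_A (lam a v) \<odot>\<^bsub>M\<^esub> x"
    and "smash_V v \<odot>\<^bsub>M\<^esub> (smash_V w \<odot>\<^bsub>M\<^esub> x) = smash_V w \<odot>\<^bsub>M\<^esub> (smash_V v \<odot>\<^bsub>M\<^esub> x)
      \<oplus>\<^bsub>M\<^esub> (smash_V (fst (kap v w)) \<odot>\<^bsub>M\<^esub> x \<oplus>\<^bsub>M\<^esub> smash_A (snd (kap v w)) \<odot>\<^bsub>M\<^esub> x)"
proof -
  let ?P = "pullback_module H.cls M"
  interpret M: left_module H.Q M using M by (simp only: smash_eqs)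
  have P: "left_module H.T ?P"
    by (rule left_module_pullback[OF H.cls.ring_hom_ring_axioms M.left_module_axioms])
  have "\<forall>g\<in>smash_relations sA \<Delta> sV act lam kap. g \<odot>\<^bsub>?P\<^esub> x = \<zero>\<^bsub>?P\<^esub>"
    using x by (simp add: H.cls_relation M.smult_l_null)
  note rel = this[unfolded smash_relations_annihilate_iff[OF P, of x, simplified, OF x] pullback_module_simps
      list_sum_pullback, folded H.gen_def, folded smash_eqs]
  show "smash_A a \<odot>\<^bsub>M\<^esub> (smash_A b \<odot>\<^bsub>M\<^esub> x) = smash_A (a * b) \<odot>\<^bsub>M\<^esub> x"
    using rel by blast
  show "smash_A 1 \<odot>\<^bsub>M\<^esub> x = x" using rel by blast
  show "smash_A a \<odot>\<^bsub>M\<^esub> (smash_V v \<odot>\<^bsub>M\<^esub> x) =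
      list_sum M (map (\<lambda>(y, z). smash_V (act y v) \<odot>\<^bsub>M\<^esub> (smash_A z \<odot>\<^bsub>M\<^esub> x)) ps)
        \<oplus>\<^bsub>M\<^esub> smash_A (lam a v) \<odot>\<^bsub>M\<^esub> x" if "\<Delta> a = tensor2 sA ps"
    using rel that by blast
  show "smash_V v \<odot>\<^bsub>M\<^esub> (smash_V w \<odot>\<^bsub>M\<^esub> x) = smash_V w \<odot>\<^bsub>M\<^esub> (smash_V v \<odot>\<^bsub>M\<^esub> x)
      \<oplus>\<^bsub>M\<^esub> (smash_V (fst (kap v w)) \<odot>\<^bsub>M\<^esub> x \<oplus>\<^bsub>M\<^esub> smash_A (snd (kap v w)) \<odot>\<^bsub>M\<^esub> x)"
    unfolding smash_module_gen[OF M x, of "fst (kap v w)" "snd (kap v w)", symmetric] prod.collapse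
    using rel by blast
qed

lemma smash_module_linear:
  assumes "left_module smash_algebra M"
  shows "linear_operators M sW (\<lambda>c x. smash_scalar c \<odot>\<^bsub>M\<^esub> x) (\<lambda>p x. H.gen p \<odot>\<^bsub>M\<^esub> x)"
  using H.linear_operators_of_module[of M] assms by (simp only: smash_eqs)

lemma smash_A_scalar:
  fixes M :: "(('k, 'v, 'a) smash, 'u) module"
  assumes "left_module smash_algebra M" "x \<in> carrier M"
  shows "smash_A (sA c 1) \<odot>\<^bsub>M\<^esub> x = smash_scalar c \<odot>\<^bsub>M\<^esub> x"
proof -
  interpret L: linear_operators M sW "\<lambda>c x. smash_scalar c \<odot>\<^bsub>M\<^esub> x" "\<lambda>p x. H.gen p \<odot>\<^bsub>M\<^esub> x"
    by (rule smash_module_linear) fact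
  have "smash_A (sA c 1) \<odot>\<^bsub>M\<^esub> x = smash_scalar c \<odot>\<^bsub>M\<^esub> (smash_A 1 \<odot>\<^bsub>M\<^esub> x)"
    using L.opr_scale[of x c "(0, 1)"] assms(2) by (simp add: smash_eqs(3) scale_prod_def)
  then show ?thesis by (simp add: smash_module_relations(2)[OF assms])
qed

lemma smash_A_add:
  fixes M :: "(('k, 'v, 'a) smash, 'u) module"
  assumes "left_module smash_algebra M" "x \<in> carrier M"
  shows "smash_A (a + b) \<odot>\<^bsub>M\<^esub> x = smash_A a \<odot>\<^bsub>M\<^esub> x \<oplus>\<^bsub>M\<^esub> smash_A b \<odot>\<^bsub>M\<^esub> x"
proof -
  interpret L: linear_operators M sW "\<lambda>c x. smash_scalar c \<odot>\<^bsub>M\<^esub> x" "\<lambda>p x. H.gen p \<odot>\<^bsub>M\<^esub> x"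
    by (rule smash_module_linear) fact
  show ?thesis
    using L.opr_l_distr[of x "(0, a)" "(0, b)"] assms(2) by (simp add: smash_eqs(3))
qed

text \<open>
  This is where \<open>A = \<mm> \<oplus> K 1\<close> enters: only the unit part of \<open>a\<close> acts on a vector killed by \<open>\<mm>\<close>.
\<close>

lemma killed_by_smash_A:
  fixes M :: "(('k, 'v, 'a) smash, 'u) module"
  assumes M: "left_module smash_algebra M" and x: "x \<in> carrier M"
    and kill: "\<And>b. b \<in> \<mm> \<Longrightarrow> smash_A b \<odot>\<^bsub>M\<^esub> x = \<zero>\<^bsub>M\<^esub>"
  shows "smash_A a \<odot>\<^bsub>M\<^esub> x = smash_scalar (aug a) \<odot>\<^bsub>M\<^esub> x"
proof -
  interpret M: left_module smash_algebra M by fact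
  obtain b where b: "b \<in> \<mm>" "a = b + sA (aug a) 1" by (rule aug_cases)
  have "smash_A (b + sA (aug a) 1) \<odot>\<^bsub>M\<^esub> x = smash_scalar (aug a) \<odot>\<^bsub>M\<^esub> x"
    using x by (simp add: smash_A_add[OF M x] smash_A_scalar[OF M x] kill[OF b(1)] M.smult_closed smash_closed)
  then show ?thesis using b(2) by simp
qed

text \<open>
  The commutator of two elements of \<open>V\<close> is an element of \<open>\<mm>\<close>, which acts as zero, so that \<open>V\<close> acts by
  commuting operators.
\<close>

lemma restriction_exists:
  fixes M :: "(('k, 'v, 'a) smash, 'u) module"
  assumes M: "left_module smash_algebra M" and kill: "killed_by \<mm> M"
    and kap: "\<And>v w. fst (kap v w) = 0" "\<And>v w. snd (kap v w) \<in> \<mm>"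
  obtains N :: "(('k, 'v) sym, 'u) module" where "left_module (sym_algebra sV) N" "restricts_to M N"
proof -
  interpret M: left_module smash_algebra M by fact
  interpret L: linear_operators M sW "\<lambda>c x. smash_scalar c \<odot>\<^bsub>M\<^esub> x" "\<lambda>p x. H.gen p \<odot>\<^bsub>M\<^esub> x"
    by (rule smash_module_linear) fact
  have op: "linear_operators M sV (\<lambda>c x. smash_scalar c \<odot>\<^bsub>M\<^esub> x) (\<lambda>v x. smash_V v \<odot>\<^bsub>M\<^esub> x)"
  proof (intro linear_operators.intro linear_operators_axioms.intro M.M.abelian_group_axioms V.vector_space_axioms)
    fix v w c x assume x: "x \<in> carrier M"
    show "smash_V (v + w) \<odot>\<^bsub>M\<^esub> x = smash_V v \<odot>\<^bsub>M\<^esub> x \<oplus>\<^bsub>M\<^esub> smash_V w \<odot>\<^bsub>M\<^esub> x"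
      using L.opr_l_distr[of x "(v, 0)" "(w, 0)"] x by (simp add: smash_eqs(2))
    show "smash_V (sV c v) \<odot>\<^bsub>M\<^esub> x = smash_scalar c \<odot>\<^bsub>M\<^esub> (smash_V v \<odot>\<^bsub>M\<^esub> x)"
      using L.opr_scale[of x c "(v, 0)"] x by (simp add: smash_eqs(2) scale_prod_def)
    show "smash_V v \<odot>\<^bsub>M\<^esub> (smash_scalar c \<odot>\<^bsub>M\<^esub> x) = smash_scalar c \<odot>\<^bsub>M\<^esub> (smash_V v \<odot>\<^bsub>M\<^esub> x)"
      using L.opr_scal[of x "(v, 0)" c] x by (simp add: smash_eqs(2))
  qed (simp_all add: L.scal_l_distr L.scal_mult L.scal_one M.smult_closed M.smult_r_distr smash_closed)
  interpret N: linear_operators M sV "\<lambda>c x. smash_scalar c \<odot>\<^bsub>M\<^esub> x" "\<lambda>v x. smash_V v \<odot>\<^bsub>M\<^esub> x"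
    by (rule op)
  have comm: "smash_V v \<odot>\<^bsub>M\<^esub> (smash_V w \<odot>\<^bsub>M\<^esub> x) = smash_V w \<odot>\<^bsub>M\<^esub> (smash_V v \<odot>\<^bsub>M\<^esub> x)"
    if x: "x \<in> carrier M" for v w x
  proof -
    have "smash_A (snd (kap v w)) \<odot>\<^bsub>M\<^esub> x = \<zero>\<^bsub>M\<^esub>"
      using kill kap(2) x by (simp add: killed_by_def)
    moreover have "smash_V 0 \<odot>\<^bsub>M\<^esub> x = \<zero>\<^bsub>M\<^esub>"
      using N.opr_scale[of x 0 0] x N.scal_zero[of "smash_V 0 \<odot>\<^bsub>M\<^esub> x"] by (simp add: N.opr_closed)
    ultimately show ?thesis
      using smash_module_relations(4)[OF M x, of v w] x
      by (simp add: kap M.smult_closed smash_closed)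
  qed
  show ?thesis
  proof (rule S.module_of_linear_operators[OF op])
    fix g x assume g: "g \<in> sym_relations sV" and x: "x \<in> carrier M"
    show "g \<odot>\<^bsub>N.tensor_module\<^esub> x = \<zero>\<^bsub>M\<^esub>"
      using sym_relations_annihilate_iff[OF N.left_module_tensor, of x] g x comm
      by (simp add: N.tvec_smult N.opr_closed)
  next
    fix N :: "(('k, 'v) sym, 'u) module"
    assume "left_module S.Q N" "carrier N = carrier M" "ring.add N = ring.add M"
      "\<And>c x. x \<in> carrier M \<Longrightarrow> S.scl c \<odot>\<^bsub>N\<^esub> x = smash_scalar c \<odot>\<^bsub>M\<^esub> x"
      "\<And>w x. x \<in> carrier M \<Longrightarrow> S.gen w \<odot>\<^bsub>N\<^esub> x = smash_V w \<odot>\<^bsub>M\<^esub> x"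
    then show ?thesis
      by (intro that[of N]) (auto simp: restricts_to_def sym_eqs)
  qed
qed

text \<open>
  The identity \<open>\<Sum> \<epsilon>(a\<^sub>2) a\<^sub>1(v) = \<epsilon>(a) v\<close>.  It is evaluated on the presentation of \<open>\<Delta>(a)\<close> as
  \<open>\<epsilon>(a) 1 \<otimes> 1\<close> plus a tensor with second factors in the kernel of \<open>\<epsilon>\<close>.
\<close>

lemma sum_aug_cop:
  assumes "\<Delta> a = tensor2 sA ps"
  shows "(\<Sum>(y, z)\<leftarrow>ps. sV (aug z) (act y v)) = sV (aug a) v"
proof -
  have "bilinear_map sA sA sV (\<lambda>y z. sV (aug z) (act y v))"
    by (auto simp: bilinear_map_def Vector_Spaces.linear_iff vector_space_axioms V.vector_space_axioms
        aug_add aug_scale bilinear_mapD[OF act_bilinear] V.scale_left_distrib V.scale_right_distrib mult.commute)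
  note B = tensor2_bilinear_eq[OF this]
  obtain qs where qs: "set qs \<subseteq> \<mm> \<times> \<mm>" "\<Delta> a = tensor2 sA (qs @ [(sA (aug a) 1, 1)])"
    by (rule cop_presentation)
  have "(\<Sum>(y, z)\<leftarrow>qs. sV (aug z) (act y v)) = 0"
    using qs(1) by (induction qs) (auto simp: aug_m)
  then show ?thesis
    using B[of ps "qs @ [(sA (aug a) 1, 1)]"] assms qs(2)
    by (simp add: aug_one act_one bilinear_mapD[OF act_bilinear])
qed

text \<open>
  The pair \<open>(v, a)\<close> acts as \<open>v + \<epsilon>(a)\<close>.  The relations for \<open>A\<close> hold because \<open>\<epsilon>\<close> is an algebra map, the
  commutation relation between \<open>A\<close> and \<open>V\<close> because of \<open>sum_aug_cop\<close> and \<open>\<epsilon> \<circ> \<lambda> = 0\<close>, and the relation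
  for \<open>\<kappa>\<close> because the operators of \<open>V\<close> commute and \<open>\<epsilon> \<circ> \<kappa>\<^sub>A = 0\<close>.
\<close>

lemma inflation_exists:
  fixes N :: "(('k, 'v) sym, 'u) module"
  assumes N: "left_module (sym_algebra sV) N"
    and lam: "\<And>a v. lam a v \<in> \<mm>"
    and kap: "\<And>v w. fst (kap v w) = 0" "\<And>v w. snd (kap v w) \<in> \<mm>"
  obtains M :: "(('k, 'v, 'a) smash, 'u) module"
  where "left_module smash_algebra M" "restricts_to M N" "killed_by \<mm> M"
proof -
  interpret N: left_module "sym_algebra sV" N by fact
  interpret L: linear_operators N sV "\<lambda>c x. sym_scalar sV c \<odot>\<^bsub>N\<^esub> x" "\<lambda>v x. sym_V sV v \<odot>\<^bsub>N\<^esub> x"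
    using S.linear_operators_of_module[of N] N by (simp only: sym_eqs)
  define opr where "opr = (\<lambda>p x. sym_V sV (fst p) \<odot>\<^bsub>N\<^esub> x \<oplus>\<^bsub>N\<^esub> sym_scalar sV (aug (snd p)) \<odot>\<^bsub>N\<^esub> x)"
  have op: "linear_operators N sW (\<lambda>c x. sym_scalar sV c \<odot>\<^bsub>N\<^esub> x) opr"
  proof (intro linear_operators.intro linear_operators_axioms.intro N.M.abelian_group_axioms H.W.vector_space_axioms)
    fix p q c x y assume x: "x \<in> carrier N"
    show "opr p (sym_scalar sV c \<odot>\<^bsub>N\<^esub> x) = sym_scalar sV c \<odot>\<^bsub>N\<^esub> opr p x"
      using x L.scal_mult[of x c "aug (snd p)"] L.scal_mult[of x "aug (snd p)" c]
      by (simp add: opr_def L.opr_scal L.scal_r_distr L.opr_closed L.scal_closed mult.commute)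
    show "opr (p + q) x = opr p x \<oplus>\<^bsub>N\<^esub> opr q x"
      using x by (simp add: opr_def aug_add L.opr_l_distr L.scal_l_distr L.opr_closed L.scal_closed N.M.a_ac)
    show "opr (sW c p) x = sym_scalar sV c \<odot>\<^bsub>N\<^esub> opr p x"
      using x by (simp add: opr_def scale_prod_def aug_scale L.opr_scale L.scal_mult L.scal_r_distr
          L.opr_closed L.scal_closed)
    show "opr p (x \<oplus>\<^bsub>N\<^esub> y) = opr p x \<oplus>\<^bsub>N\<^esub> opr p y" if "y \<in> carrier N"
      using x that by (simp add: opr_def L.opr_r_distr L.scal_r_distr L.opr_closed L.scal_closed N.M.a_ac)
    show "opr p x \<in> carrier N" using x by (simp add: opr_def L.opr_closed L.scal_closed)
  qed (simp_all add: L.scal_closed L.scal_r_distr L.scal_l_distr L.scal_mult L.scal_one)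
  interpret M: linear_operators N sW "\<lambda>c x. sym_scalar sV c \<odot>\<^bsub>N\<^esub> x" opr by (rule op)
  have V0: "sym_V sV 0 \<odot>\<^bsub>N\<^esub> x = \<zero>\<^bsub>N\<^esub>" if "x \<in> carrier N" for x
    using L.opr_scale[of x 0 0] that L.scal_zero[of "sym_V sV 0 \<odot>\<^bsub>N\<^esub> x"] by (simp add: L.opr_closed)
  have opr_V: "opr (v, 0) x = sym_V sV v \<odot>\<^bsub>N\<^esub> x" if "x \<in> carrier N" for v x
    using that aug_m[of 0] m_closed(1) by (simp add: opr_def L.scal_zero L.opr_closed)
  have opr_A: "opr (0, a) x = sym_scalar sV (aug a) \<odot>\<^bsub>N\<^esub> x" if "x \<in> carrier N" for a x
    using that by (simp add: opr_def V0 L.scal_closed)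
  have comm: "sym_V sV v \<odot>\<^bsub>N\<^esub> (sym_V sV w \<odot>\<^bsub>N\<^esub> x) = sym_V sV w \<odot>\<^bsub>N\<^esub> (sym_V sV v \<odot>\<^bsub>N\<^esub> x)"
    if x: "x \<in> carrier N" for v w x
  proof -
    interpret Q: left_module S.Q N using N by (simp only: sym_eqs)
    have P: "left_module S.T (pullback_module S.cls N)"
      by (rule left_module_pullback[OF S.cls.ring_hom_ring_axioms Q.left_module_axioms])
    have "\<forall>g\<in>sym_relations sV. g \<odot>\<^bsub>pullback_module S.cls N\<^esub> x = \<zero>\<^bsub>pullback_module S.cls N\<^esub>"
      using x by (simp add: S.cls_relation Q.smult_l_null)
    with sym_relations_annihilate_iff[OF P, of x] x show ?thesis
      by (simp add: sym_eqs S.gen_def)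
  qed
  have sum: "list_sum N (map (\<lambda>(y, z). sym_V sV (act y v) \<odot>\<^bsub>N\<^esub> (sym_scalar sV (aug z) \<odot>\<^bsub>N\<^esub> x)) ps) =
      sym_V sV (\<Sum>(y, z)\<leftarrow>ps. sV (aug z) (act y v)) \<odot>\<^bsub>N\<^esub> x" if x: "x \<in> carrier N" for x v ps
    by (induction ps)
      (use x in \<open>auto simp: list_sum_def V0 L.opr_l_distr L.opr_scale L.opr_scal\<close>)
  have rel: "g \<odot>\<^bsub>M.tensor_module\<^esub> x = \<zero>\<^bsub>N\<^esub>"
    if g: "g \<in> smash_relations sA \<Delta> sV act lam kap" and x: "x \<in> carrier N" for g x
  proof -
    have [simp]: "list_sum M.tensor_module = list_sum N"
      by (simp add: list_sum_def[abs_def])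
    have A: "tvec sW (0, a) \<odot>\<^bsub>M.tensor_module\<^esub> x = sym_scalar sV (aug a) \<odot>\<^bsub>N\<^esub> x"
      and W: "tvec sW (v, 0) \<odot>\<^bsub>M.tensor_module\<^esub> x = sym_V sV v \<odot>\<^bsub>N\<^esub> x"
      if "x \<in> carrier N" for a v x
      using that by (simp_all add: M.tvec_smult opr_A opr_V)
    have sum': "list_sum N (map (\<lambda>(y, z). sym_V sV (act y v) \<odot>\<^bsub>N\<^esub> (sym_scalar sV (aug z) \<odot>\<^bsub>N\<^esub> x)) ps)
        = sym_scalar sV (aug a) \<odot>\<^bsub>N\<^esub> (sym_V sV v \<odot>\<^bsub>N\<^esub> x)"
      if "\<Delta> a = tensor2 sA ps" for a v ps
      using x by (simp add: sum[OF x] sum_aug_cop[OF that] L.opr_scale)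
    have lam0: "aug (lam a v) = 0" for a v using lam aug_m by blast
    have kap0: "tvec sW (kap v w) \<odot>\<^bsub>M.tensor_module\<^esub> x = \<zero>\<^bsub>N\<^esub>" for v w
    proof -
      obtain b where "kap v w = (0, b)" "b \<in> \<mm>"
        using kap[of v w] by (metis prod.collapse)
      then show ?thesis using x aug_m by (simp add: A L.scal_zero)
    qed
    have "\<forall>g\<in>smash_relations sA \<Delta> sV act lam kap. g \<odot>\<^bsub>M.tensor_module\<^esub> x = \<zero>\<^bsub>M.tensor_module\<^esub>"
      using x
      by (subst smash_relations_annihilate_iff[OF M.left_module_tensor])
        (auto simp: A W sum' kap0 lam0 aug_mult aug_one L.scal_mult L.scal_one L.scal_closed L.opr_closed
          L.opr_scale L.scal_zero intro: comm)
    with g show ?thesis by simp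
  qed
  show ?thesis
  proof (rule H.module_of_linear_operators[OF op rel])
    fix M :: "(('k, 'v, 'a) smash, 'u) module"
    assume M: "left_module H.Q M" "carrier M = carrier N" "ring.zero M = ring.zero N" "ring.add M = ring.add N"
      "\<And>c x. x \<in> carrier N \<Longrightarrow> H.scl c \<odot>\<^bsub>M\<^esub> x = sym_scalar sV c \<odot>\<^bsub>N\<^esub> x"
      "\<And>w x. x \<in> carrier N \<Longrightarrow> H.gen w \<odot>\<^bsub>M\<^esub> x = opr w x"
    show ?thesis
    proof (rule that[of M])
      show "left_module smash_algebra M" using M(1) by (simp only: smash_eqs)
      show "restricts_to M N"
        using M(2-) by (simp add: restricts_to_def smash_eqs opr_V)
      show "killed_by \<mm> M"
        using M(2-) by (auto simp: killed_by_def smash_eqs opr_A aug_m L.scal_zero)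
    qed
  qed
qed

end

section \<open>Simple modules\<close>

lemma equiv_simple_iso_rel:
  fixes R :: "'r ring"
  shows "equiv (simple_modules R) (simple_iso_rel R :: (('r, 'u) module \<times> ('r, 'u) module) set)"
proof (rule equivI)
  let ?r = "simple_iso_rel R :: (('r, 'u) module \<times> ('r, 'u) module) set"
  show "?r \<subseteq> simple_modules R \<times> simple_modules R"
    by (auto simp: simple_iso_rel_def)
  have "module_iso R M M" for M :: "('r, 'u) module"
    unfolding module_iso_def by (intro exI[of _ id]) auto
  then show "refl_on (simple_modules R) ?r"
    by (auto simp: refl_on_def simple_iso_rel_def)
  have "module_iso R N M" if M: "left_module R M" and iso: "module_iso R M N" for M N :: "('r, 'u) module"
  proof -
    interpret M: left_module R M by fact
    obtain f where f: "bij_betw f (carrier M) (carrier N)"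
      "\<And>x y. x \<in> carrier M \<Longrightarrow> y \<in> carrier M \<Longrightarrow> f (x \<oplus>\<^bsub>M\<^esub> y) = f x \<oplus>\<^bsub>N\<^esub> f y"
      "\<And>r x. r \<in> carrier R \<Longrightarrow> x \<in> carrier M \<Longrightarrow> f (r \<odot>\<^bsub>M\<^esub> x) = r \<odot>\<^bsub>N\<^esub> f x"
      using iso unfolding module_iso_def by blast
    define g where "g = inv_into (carrier M) f"
    have g: "bij_betw g (carrier N) (carrier M)" "\<And>y. y \<in> carrier N \<Longrightarrow> g y \<in> carrier M \<and> f (g y) = y"
        "\<And>x. x \<in> carrier M \<Longrightarrow> g (f x) = x"
      using f(1) bij_betw_inv_into[OF f(1)]
      by (auto simp: g_def bij_betw_inv_into_right bij_betw_inv_into_left bij_betwE)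
    have "g (x \<oplus>\<^bsub>N\<^esub> y) = g x \<oplus>\<^bsub>M\<^esub> g y" if "x \<in> carrier N" "y \<in> carrier N" for x y
      using g(3)[of "g x \<oplus>\<^bsub>M\<^esub> g y"] g(2)[OF that(1)] g(2)[OF that(2)] f(2)[of "g x" "g y"] by simp
    moreover have "g (r \<odot>\<^bsub>N\<^esub> x) = r \<odot>\<^bsub>M\<^esub> g x" if "r \<in> carrier R" "x \<in> carrier N" for r x
      using g(3)[of "r \<odot>\<^bsub>M\<^esub> g x"] g(2)[OF that(2)] f(3)[of r "g x"] that M.smult_closed by simp
    ultimately show ?thesis unfolding module_iso_def using g(1) by blast
  qed
  then show "sym ?r"
    by (auto simp: sym_def simple_iso_rel_def simple_modules_def)
  have "module_iso R M P" if iso: "module_iso R M N" "module_iso R N P" for M N P :: "('r, 'u) module"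
  proof -
    obtain f where f: "bij_betw f (carrier M) (carrier N)"
      "\<forall>x\<in>carrier M. \<forall>y\<in>carrier M. f (x \<oplus>\<^bsub>M\<^esub> y) = f x \<oplus>\<^bsub>N\<^esub> f y"
      "\<forall>r\<in>carrier R. \<forall>x\<in>carrier M. f (r \<odot>\<^bsub>M\<^esub> x) = r \<odot>\<^bsub>N\<^esub> f x"
      using iso(1) unfolding module_iso_def by blast
    obtain g where g: "bij_betw g (carrier N) (carrier P)"
      "\<forall>x\<in>carrier N. \<forall>y\<in>carrier N. g (x \<oplus>\<^bsub>N\<^esub> y) = g x \<oplus>\<^bsub>P\<^esub> g y"
      "\<forall>r\<in>carrier R. \<forall>x\<in>carrier N. g (r \<odot>\<^bsub>N\<^esub> x) = r \<odot>\<^bsub>P\<^esub> g x"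
      using iso(2) unfolding module_iso_def by blast
    show ?thesis
      unfolding module_iso_def
      using f g bij_betw_trans[OF f(1) g(1)] bij_betwE[OF f(1)]
      by (intro exI[of _ "g \<circ> f"]) auto
  qed
  then show "trans ?r"
    unfolding trans_def simple_iso_rel_def by blast
qed

text \<open>
  Restriction is a relation between modules rather than a function, since it fixes the operations of
  the restricted module only on its carrier.  A relation that is total on both sides and matches
  the two equivalences descends to a bijection of the classes.
\<close>

lemma quotient_bijection_of_relation:
  assumes r: "equiv S r" and r': "equiv S' r'"
    and total: "\<And>x. x \<in> S \<Longrightarrow> \<exists>y\<in>S'. P x y" and surj: "\<And>y. y \<in> S' \<Longrightarrow> \<exists>x\<in>S. P x y"
    and compat: "\<And>x x' y y'. \<lbrakk>x \<in> S; x' \<in> S; y \<in> S'; y' \<in> S'; P x y; P x' y'\<rbrakk>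
      \<Longrightarrow> (x, x') \<in> r \<longleftrightarrow> (y, y') \<in> r'"
  shows "\<exists>\<Phi>. bij_betw \<Phi> (S // r) (S' // r') \<and>
    (\<forall>x\<in>S. \<forall>y\<in>S'. P x y \<longrightarrow> \<Phi> (r `` {x}) = r' `` {y})"
proof -
  define \<Phi> where "\<Phi> = (\<lambda>C. {y'. \<exists>x\<in>C. \<exists>y\<in>S'. P x y \<and> (y, y') \<in> r'})"
  have \<Phi>: "\<Phi> (r `` {x}) = r' `` {y}" if xy: "x \<in> S" "y \<in> S'" "P x y" for x y
  proof (intro Set.set_eqI iffI)
    fix z assume "z \<in> \<Phi> (r `` {x})"
    then obtain x' y' where *: "(x, x') \<in> r" "y' \<in> S'" "P x' y'" "(y', z) \<in> r'"
      by (auto simp: \<Phi>_def)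
    have "x' \<in> S" using *(1) r by (auto elim: equivE)
    then have "(y, y') \<in> r'" using compat[of x x' y y'] xy * by blast
    then show "z \<in> r' `` {y}" using *(4) r' by (auto elim!: equivE dest: transD)
  next
    fix z assume "z \<in> r' `` {y}"
    moreover have "(x, x) \<in> r" using xy(1) r by (auto elim!: equivE dest: refl_onD)
    ultimately show "z \<in> \<Phi> (r `` {x})" using xy by (auto simp: \<Phi>_def)
  qed
  have "bij_betw \<Phi> (S // r) (S' // r')"
  proof (rule bij_betw_imageI[OF inj_onI subset_antisym[OF subsetI subsetI]])
    fix C D assume "C \<in> S // r" "D \<in> S // r" and eq: "\<Phi> C = \<Phi> D"
    then obtain x x' where x: "x \<in> S" "C = r `` {x}" "x' \<in> S" "D = r `` {x'}"
      by (auto elim!: quotientE)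
    obtain y y' where y: "y \<in> S'" "P x y" "y' \<in> S'" "P x' y'" using total x by meson
    have "r' `` {y} = r' `` {y'}" using eq \<Phi> x y by simp
    then have "(y, y') \<in> r'" using r' y by (simp add: eq_equiv_class_iff)
    then show "C = D" using compat[of x x' y y'] x y r by (simp add: eq_equiv_class_iff)
  next
    fix D assume "D \<in> \<Phi> ` (S // r)"
    then obtain x where x: "x \<in> S" "D = \<Phi> (r `` {x})" by (auto elim!: quotientE)
    obtain y where "y \<in> S'" "P x y" using total x by blast
    then show "D \<in> S' // r'" using \<Phi> x by (auto intro: quotientI)
  next
    fix D assume "D \<in> S' // r'"
    then obtain y where y: "y \<in> S'" "D = r' `` {y}" by (auto elim!: quotientE)
    obtain x where x: "x \<in> S" "P x y" using surj y by blast
    then have "D = \<Phi> (r `` {x})" using \<Phi> y by simp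
    then show "D \<in> \<Phi> ` (S // r)" using x by (auto intro: quotientI)
  qed
  then show ?thesis using \<Phi> by blast
qed

context deformation_data
begin

lemma smash_submoduleI:
  fixes M :: "(('k, 'v, 'a) smash, 'u) module"
  assumes M: "left_module smash_algebra M" and "K \<subseteq> carrier M" "\<zero>\<^bsub>M\<^esub> \<in> K"
    and add: "\<And>x y. x \<in> K \<Longrightarrow> y \<in> K \<Longrightarrow> x \<oplus>\<^bsub>M\<^esub> y \<in> K"
    and "\<And>c x. x \<in> K \<Longrightarrow> smash_scalar c \<odot>\<^bsub>M\<^esub> x \<in> K"
    and "\<And>v x. x \<in> K \<Longrightarrow> smash_V v \<odot>\<^bsub>M\<^esub> x \<in> K" "\<And>a x. x \<in> K \<Longrightarrow> smash_A a \<odot>\<^bsub>M\<^esub> x \<in> K"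
  shows "submodule K smash_algebra M"
  unfolding smash_eqs
proof (rule H.submodule_generators)
  fix p x assume "x \<in> K"
  then show "H.gen p \<odot>\<^bsub>M\<^esub> x \<in> K"
    using smash_module_gen[OF M, of x "fst p" "snd p"] assms by auto
qed (use assms in \<open>auto simp: smash_eqs\<close>)

text \<open>
  This is where nilpotency enters: if \<open>\<mm>\<^bsup>k+1\<^esup> x = 0\<close>, then \<open>\<mm>\<^sup>k\<close> kills every \<open>b x\<close> with \<open>b \<in> \<mm>\<close>, so by
  induction \<open>\<mm> x = 0\<close> and hence \<open>x = 0\<close>; some power of \<open>\<mm>\<close> is zero, so this reaches every \<open>x\<close>.
\<close>

lemma zero_if_annihilator_trivial:
  fixes M :: "(('k, 'v, 'a) smash, 'u) module"
  assumes M: "left_module smash_algebra M" and x: "x \<in> carrier M"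
    and zero: "\<And>x. \<lbrakk>x \<in> carrier M; \<forall>a\<in>\<mm>. smash_A a \<odot>\<^bsub>M\<^esub> x = \<zero>\<^bsub>M\<^esub>\<rbrakk> \<Longrightarrow> x = \<zero>\<^bsub>M\<^esub>"
  shows "x = \<zero>\<^bsub>M\<^esub>"
proof -
  interpret M: left_module smash_algebra M by fact
  have A0: "smash_A 0 \<odot>\<^bsub>M\<^esub> x = \<zero>\<^bsub>M\<^esub>" if "x \<in> carrier M" for x
    using smash_A_add[OF M that, of 0 0] M.smult_closed[OF smash_closed(2) that, of 0] M.M.add.l_cancel_one'
    by fastforce
  have step: "x = \<zero>\<^bsub>M\<^esub>" if "x \<in> carrier M" "\<forall>a\<in>ideal_power \<mm> k. smash_A a \<odot>\<^bsub>M\<^esub> x = \<zero>\<^bsub>M\<^esub>" for k x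
    using that
  proof (induction k arbitrary: x)
    case 0
    then show ?case using smash_module_relations(2)[OF M, of x] by (simp add: ideal_power_0)
  next
    case (Suc k)
    have "smash_A b \<odot>\<^bsub>M\<^esub> x = \<zero>\<^bsub>M\<^esub>" if b: "b \<in> \<mm>" for b
    proof (rule Suc.IH)
      show "smash_A b \<odot>\<^bsub>M\<^esub> x \<in> carrier M" using Suc.prems by (simp add: M.smult_closed smash_closed)
      show "\<forall>a\<in>ideal_power \<mm> k. smash_A a \<odot>\<^bsub>M\<^esub> (smash_A b \<odot>\<^bsub>M\<^esub> x) = \<zero>\<^bsub>M\<^esub>"
        using Suc.prems ideal_power_mult[OF _ b] by (simp add: smash_module_relations(1)[OF M])
    qed
    then show ?case using zero Suc.prems(1) by blast
  qed
  obtain n where "ideal_power \<mm> n = {0}" using nilpotent by blast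
  then show ?thesis using step[OF x, of n] A0[OF x] by simp
qed

text \<open>
  The vectors killed by \<open>\<mm>\<close> form a submodule \<open>K\<close>: stability under \<open>V\<close> follows from
  \<open>b v = \<Sum> b\<^sub>1(v) b\<^sub>2 + \<lambda>(b, v)\<close> for \<open>b \<in> \<mm>\<close>, because \<open>b\<^sub>2\<close> and \<open>\<lambda>(b, v)\<close> lie in \<open>\<mm>\<close> again.
\<close>

lemma simple_module_killed:
  fixes M :: "(('k, 'v, 'a) smash, 'u) module"
  assumes simple: "M \<in> simple_modules smash_algebra" and lam: "\<And>a v. a \<in> \<mm> \<Longrightarrow> lam a v \<in> \<mm>"
  shows "killed_by \<mm> M"
proof -
  have M: "left_module smash_algebra M" using simple by (simp add: simple_modules_def)
  interpret M: left_module smash_algebra M by fact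
  define K where "K = {x \<in> carrier M. \<forall>a\<in>\<mm>. smash_A a \<odot>\<^bsub>M\<^esub> x = \<zero>\<^bsub>M\<^esub>}"
  have "submodule K smash_algebra M"
  proof (rule smash_submoduleI[OF M])
    fix c v a x assume "x \<in> K"
    then have x: "x \<in> carrier M" and kill: "\<And>a. a \<in> \<mm> \<Longrightarrow> smash_A a \<odot>\<^bsub>M\<^esub> x = \<zero>\<^bsub>M\<^esub>"
      by (auto simp: K_def)
    show A: "smash_A a \<odot>\<^bsub>M\<^esub> x \<in> K" for a
      using x kill m_closed(4) by (auto simp: K_def smash_module_relations(1)[OF M x] M.smult_closed smash_closed)
    show "smash_scalar c \<odot>\<^bsub>M\<^esub> x \<in> K"
      using A[of "sA c 1"] by (simp add: smash_A_scalar[OF M x])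
    have "smash_A b \<odot>\<^bsub>M\<^esub> (smash_V v \<odot>\<^bsub>M\<^esub> x) = \<zero>\<^bsub>M\<^esub>" if b: "b \<in> \<mm>" for b
    proof -
      obtain ps where ps: "set ps \<subseteq> \<mm> \<times> \<mm>" "\<Delta> b = tensor2 sA ps" using cop_m[OF b] by blast
      from ps(1) have "list_sum M (map (\<lambda>(y, z). smash_V (act y v) \<odot>\<^bsub>M\<^esub> (smash_A z \<odot>\<^bsub>M\<^esub> x)) ps) = \<zero>\<^bsub>M\<^esub>"
        by (induction ps) (auto simp: list_sum_def kill M.smult_r_null smash_closed)
      then show ?thesis
        using smash_module_relations(3)[OF M x ps(2)] by (simp add: kill lam b)
    qed
    then show "smash_V v \<odot>\<^bsub>M\<^esub> x \<in> K" using x by (simp add: K_def M.smult_closed smash_closed)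
  qed (auto simp: K_def M.smult_r_distr M.smult_r_null smash_closed)
  then have "K = {\<zero>\<^bsub>M\<^esub>} \<or> K = carrier M" using simple by (simp add: simple_modules_def)
  moreover have "K \<noteq> {\<zero>\<^bsub>M\<^esub>}"
  proof
    assume "K = {\<zero>\<^bsub>M\<^esub>}"
    then have "x = \<zero>\<^bsub>M\<^esub>" if "x \<in> carrier M" "\<forall>a\<in>\<mm>. smash_A a \<odot>\<^bsub>M\<^esub> x = \<zero>\<^bsub>M\<^esub>" for x
      using that unfolding K_def by blast
    then have "x = \<zero>\<^bsub>M\<^esub>" if "x \<in> carrier M" for x
      using zero_if_annihilator_trivial[OF M that] by blast
    then have "carrier M = {\<zero>\<^bsub>M\<^esub>}" using M.M.zero_closed by blast
    then show False using simple by (simp add: simple_modules_def)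
  qed
  ultimately show ?thesis by (auto simp: K_def killed_by_def)
qed

lemma restricts_toD:
  assumes "restricts_to M N"
  shows "carrier N = carrier M"
    and "\<lbrakk>x \<in> carrier M; y \<in> carrier M\<rbrakk> \<Longrightarrow> x \<oplus>\<^bsub>N\<^esub> y = x \<oplus>\<^bsub>M\<^esub> y"
    and "x \<in> carrier M \<Longrightarrow> sym_scalar sV c \<odot>\<^bsub>N\<^esub> x = smash_scalar c \<odot>\<^bsub>M\<^esub> x"
    and "x \<in> carrier M \<Longrightarrow> sym_V sV v \<odot>\<^bsub>N\<^esub> x = smash_V v \<odot>\<^bsub>M\<^esub> x"
  using assms by (simp_all add: restricts_to_def)

lemma restricts_to_zero:
  fixes M :: "(('k, 'v, 'a) smash, 'u) module" and N :: "(('k, 'v) sym, 'u) module"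
  assumes "left_module smash_algebra M" "left_module (sym_algebra sV) N" "restricts_to M N"
  shows "\<zero>\<^bsub>M\<^esub> = \<zero>\<^bsub>N\<^esub>"
proof -
  interpret M: left_module smash_algebra M by fact
  interpret N: left_module "sym_algebra sV" N by fact
  have "\<zero>\<^bsub>M\<^esub> \<in> carrier N" "\<zero>\<^bsub>M\<^esub> \<oplus>\<^bsub>N\<^esub> \<zero>\<^bsub>M\<^esub> = \<zero>\<^bsub>M\<^esub>"
    using assms(3) M.M.zero_closed M.M.l_zero[OF M.M.zero_closed] by (auto simp: restricts_to_def)
  then show ?thesis using N.M.add.l_cancel_one' by fastforce
qed

text \<open>
  As \<open>A\<close> acts by scalars on a module killed by \<open>\<mm>\<close>, closure under the smash product is closure under
  scalars and \<open>V\<close>, which is what closure under the symmetric algebra means.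
\<close>

lemma submodule_restricts_iff:
  fixes M :: "(('k, 'v, 'a) smash, 'u) module" and N :: "(('k, 'v) sym, 'u) module"
  assumes M: "left_module smash_algebra M" and N: "left_module (sym_algebra sV) N"
    and res: "restricts_to M N" and kill: "killed_by \<mm> M"
  shows "submodule K smash_algebra M \<longleftrightarrow> submodule K (sym_algebra sV) N"
proof
  assume K: "submodule K smash_algebra M"
  note K' = submodule_facts[OF K]
  have sub: "x \<in> carrier M" if "x \<in> K" for x using K'(1) that by blast
  show "submodule K (sym_algebra sV) N"
    unfolding sym_eqs
  proof (rule S.submodule_generators)
    show "left_module S.Q N" using N by (simp only: sym_eqs)
    show "K \<subseteq> carrier N" using res K'(1) by (simp add: restricts_to_def)
    show "\<zero>\<^bsub>N\<^esub> \<in> K" using K'(2) restricts_to_zero[OF M N res] by simp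
    show "x \<oplus>\<^bsub>N\<^esub> y \<in> K" if "x \<in> K" "y \<in> K" for x y
      using K'(3)[OF that] res sub that by (simp add: restricts_to_def)
    show "S.scl c \<odot>\<^bsub>N\<^esub> x \<in> K" if "x \<in> K" for c x
      using K'(4)[OF smash_closed(3) that, of c] res sub that by (simp add: restricts_to_def sym_eqs)
    show "S.gen w \<odot>\<^bsub>N\<^esub> x \<in> K" if "x \<in> K" for w x
      using K'(4)[OF smash_closed(1) that, of w] res sub that by (simp add: restricts_to_def sym_eqs)
  qed
next
  assume K: "submodule K (sym_algebra sV) N"
  note K' = submodule_facts[OF K]
  have sub: "x \<in> carrier M" if "x \<in> K" for x using K'(1) that res by (auto simp: restricts_to_def)
  have scal: "smash_scalar c \<odot>\<^bsub>M\<^esub> x \<in> K" if "x \<in> K" for c x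
    using K'(4)[OF sym_closed(2) that, of c] res sub that by (simp add: restricts_to_def)
  show "submodule K smash_algebra M"
  proof (rule smash_submoduleI[OF M])
    show "K \<subseteq> carrier M" using sub by blast
    show "\<zero>\<^bsub>M\<^esub> \<in> K" using K'(2) restricts_to_zero[OF M N res] by simp
    show "x \<oplus>\<^bsub>M\<^esub> y \<in> K" if "x \<in> K" "y \<in> K" for x y
      using K'(3)[OF that] res sub that by (simp add: restricts_to_def)
    show "smash_V w \<odot>\<^bsub>M\<^esub> x \<in> K" if "x \<in> K" for w x
      using K'(4)[OF sym_closed(1) that, of w] res sub that by (simp add: restricts_to_def)
    show "smash_A a \<odot>\<^bsub>M\<^esub> x \<in> K" if "x \<in> K" for a x
      using killed_by_smash_A[OF M sub[OF that], of a] kill scal that sub by (simp add: killed_by_def)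
  qed (rule scal)
qed

lemma simple_restricts_iff:
  fixes M :: "(('k, 'v, 'a) smash, 'u) module" and N :: "(('k, 'v) sym, 'u) module"
  assumes M: "left_module smash_algebra M" and N: "left_module (sym_algebra sV) N"
    and res: "restricts_to M N" and kill: "killed_by \<mm> M"
  shows "M \<in> simple_modules smash_algebra \<longleftrightarrow> N \<in> simple_modules (sym_algebra sV)"
  using res submodule_restricts_iff[OF assms] restricts_to_zero[OF M N res] M N
  by (simp add: simple_modules_def restricts_to_def)

text \<open>
  Again because \<open>A\<close> acts by scalars: an additive map commuting with scalars and \<open>V\<close> commutes with \<open>A\<close>.
\<close>

lemma module_iso_restricts_iff:
  fixes M M' :: "(('k, 'v, 'a) smash, 'u) module" and N N' :: "(('k, 'v) sym, 'u) module"
  assumes M: "left_module smash_algebra M" "left_module smash_algebra M'"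
    and N: "left_module (sym_algebra sV) N" "left_module (sym_algebra sV) N'"
    and res: "restricts_to M N" "restricts_to M' N'" and kill: "killed_by \<mm> M" "killed_by \<mm> M'"
  shows "module_iso smash_algebra M M' \<longleftrightarrow> module_iso (sym_algebra sV) N N'"
proof -
  interpret M: left_module smash_algebra M by (rule M)
  have smult_iff: "(\<forall>r\<in>carrier smash_algebra. \<forall>x\<in>carrier M. f (r \<odot>\<^bsub>M\<^esub> x) = r \<odot>\<^bsub>M'\<^esub> f x) \<longleftrightarrow>
      (\<forall>r\<in>carrier (sym_algebra sV). \<forall>x\<in>carrier N. f (r \<odot>\<^bsub>N\<^esub> x) = r \<odot>\<^bsub>N'\<^esub> f x)" (is "?L \<longleftrightarrow> ?R")
    if f: "f \<in> carrier M \<rightarrow> carrier M'"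
      and add: "\<And>x y. x \<in> carrier M \<Longrightarrow> y \<in> carrier M \<Longrightarrow> f (x \<oplus>\<^bsub>M\<^esub> y) = f x \<oplus>\<^bsub>M'\<^esub> f y" for f
  proof
    have fx: "f x \<in> carrier M'" if "x \<in> carrier M" for x using f that by blast
    have add': "f (x \<oplus>\<^bsub>N\<^esub> y) = f x \<oplus>\<^bsub>N'\<^esub> f y" if "x \<in> carrier N" "y \<in> carrier N" for x y
      using add[of x y] that res fx by (simp add: restricts_to_def)
    {
      assume L: ?L
      show ?R
      proof (intro ballI)
        fix r x assume r: "r \<in> carrier (sym_algebra sV)" and x: "x \<in> carrier N"
        show "f (r \<odot>\<^bsub>N\<^esub> x) = r \<odot>\<^bsub>N'\<^esub> f x"
        proof (rule S.module_hom_generators[of N N' f])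
          show "f \<in> carrier N \<rightarrow> carrier N'" using f res by (simp add: restricts_to_def)
          show "f (S.scl c \<odot>\<^bsub>N\<^esub> x) = S.scl c \<odot>\<^bsub>N'\<^esub> f x" if "x \<in> carrier N" for c x
            using L[rule_format, OF smash_closed(3), of x c] that fx[of x]
            by (simp add: restricts_toD[OF res(1)] restricts_toD[OF res(2)] flip: sym_eqs)
          show "f (S.gen w \<odot>\<^bsub>N\<^esub> x) = S.gen w \<odot>\<^bsub>N'\<^esub> f x" if "x \<in> carrier N" for w x
            using L[rule_format, OF smash_closed(1), of x w] that fx[of x]
            by (simp add: restricts_toD[OF res(1)] restricts_toD[OF res(2)] flip: sym_eqs)
        qed (use N r x add' in \<open>simp_all add: sym_eqs\<close>)
      qed
    next
      assume R: ?R
      have scal: "f (smash_scalar c \<odot>\<^bsub>M\<^esub> x) = smash_scalar c \<odot>\<^bsub>M'\<^esub> f x" if "x \<in> carrier M" for c x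
        using R[rule_format, OF sym_closed(2), of x c] that fx[of x]
        by (simp add: restricts_toD[OF res(1)] restricts_toD[OF res(2)])
      have V: "f (smash_V v \<odot>\<^bsub>M\<^esub> x) = smash_V v \<odot>\<^bsub>M'\<^esub> f x" if "x \<in> carrier M" for v x
        using R[rule_format, OF sym_closed(1), of x v] that fx[of x]
        by (simp add: restricts_toD[OF res(1)] restricts_toD[OF res(2)])
      have A: "f (smash_A a \<odot>\<^bsub>M\<^esub> x) = smash_A a \<odot>\<^bsub>M'\<^esub> f x" if "x \<in> carrier M" for a x
        using killed_by_smash_A[OF M(1) that, of a] killed_by_smash_A[OF M(2) fx[OF that], of a]
          kill that fx scal by (simp add: killed_by_def)
      show ?L
      proof (intro ballI)
        fix r x assume r: "r \<in> carrier smash_algebra" and x: "x \<in> carrier M"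
        show "f (r \<odot>\<^bsub>M\<^esub> x) = r \<odot>\<^bsub>M'\<^esub> f x"
        proof (rule H.module_hom_generators[of M M' f])
          show "f (H.scl c \<odot>\<^bsub>M\<^esub> x) = H.scl c \<odot>\<^bsub>M'\<^esub> f x" if "x \<in> carrier M" for c x
            using scal[OF that] by (simp add: smash_eqs)
          show "f (H.gen p \<odot>\<^bsub>M\<^esub> x) = H.gen p \<odot>\<^bsub>M'\<^esub> f x" if "x \<in> carrier M" for p x
            using smash_module_gen[OF M(1) that, of "fst p" "snd p"]
              smash_module_gen[OF M(2) fx[OF that], of "fst p" "snd p"]
            by (simp add: add that V A M.smult_closed smash_closed)
        qed (use M f r x add in \<open>simp_all add: smash_eqs\<close>)
      qed
    }
  qed
  have add_iff: "(\<forall>x\<in>carrier M. \<forall>y\<in>carrier M. f (x \<oplus>\<^bsub>M\<^esub> y) = f x \<oplus>\<^bsub>M'\<^esub> f y) \<longleftrightarrow>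
      (\<forall>x\<in>carrier N. \<forall>y\<in>carrier N. f (x \<oplus>\<^bsub>N\<^esub> y) = f x \<oplus>\<^bsub>N'\<^esub> f y)"
    if "f \<in> carrier M \<rightarrow> carrier M'" for f
    using that res by (auto simp: restricts_to_def Pi_iff)
  show ?thesis
    unfolding module_iso_def
  proof (rule iff_exI)
    fix f
    show "(bij_betw f (carrier M) (carrier M') \<and>
        (\<forall>x\<in>carrier M. \<forall>y\<in>carrier M. f (x \<oplus>\<^bsub>M\<^esub> y) = f x \<oplus>\<^bsub>M'\<^esub> f y) \<and>
        (\<forall>r\<in>carrier smash_algebra. \<forall>x\<in>carrier M. f (r \<odot>\<^bsub>M\<^esub> x) = r \<odot>\<^bsub>M'\<^esub> f x)) =
      (bij_betw f (carrier N) (carrier N') \<and>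
        (\<forall>x\<in>carrier N. \<forall>y\<in>carrier N. f (x \<oplus>\<^bsub>N\<^esub> y) = f x \<oplus>\<^bsub>N'\<^esub> f y) \<and>
        (\<forall>r\<in>carrier (sym_algebra sV). \<forall>x\<in>carrier N. f (r \<odot>\<^bsub>N\<^esub> x) = r \<odot>\<^bsub>N'\<^esub> f x))"
      (is "(?B \<and> ?A \<and> ?S) = (?B' \<and> ?A' \<and> ?S')")
    proof -
      have B: "?B = ?B'" by (simp only: restricts_toD(1)[OF res(1)] restricts_toD(1)[OF res(2)])
      have A: "?A = ?A'" if ?B using add_iff[OF bij_betw_imp_funcset[OF that]] .
      have S: "?S = ?S'" if ?B ?A
        using smult_iff[OF bij_betw_imp_funcset[OF that(1)] that(2)[rule_format]] .
      from A S show ?thesis unfolding B[symmetric] by (intro conj_cong) simp_all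
    qed
  qed
qed

end

section \<open>One-dimensional modules\<close>

context deformation_data
begin

lemma restriction_bijection_exists:
  assumes lam: "\<And>a v. lam a v \<in> \<mm>"
    and kap: "\<And>v w. fst (kap v w) = 0" "\<And>v w. snd (kap v w) \<in> \<mm>"
  shows "\<exists>\<Phi> :: (('k, 'v, 'a) smash, 'u) module set \<Rightarrow> (('k, 'v) sym, 'u) module set.
    restriction_bijection \<mm> \<Phi>"
proof -
  let ?SH = "simple_modules smash_algebra :: (('k, 'v, 'a) smash, 'u) module set"
  let ?SS = "simple_modules (sym_algebra sV) :: (('k, 'v) sym, 'u) module set"
  let ?iH = "simple_iso_rel smash_algebra :: ((('k, 'v, 'a) smash, 'u) module \<times> _) set"
  let ?iS = "simple_iso_rel (sym_algebra sV) :: ((('k, 'v) sym, 'u) module \<times> _) set"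
  have killed: "killed_by \<mm> M" if "M \<in> ?SH" for M
    using simple_module_killed[OF that] lam by blast
  have HM: "left_module smash_algebra M" if "M \<in> ?SH" for M using that by (simp add: simple_modules_def)
  have SN: "left_module (sym_algebra sV) N" if "N \<in> ?SS" for N using that by (simp add: simple_modules_def)
  have restrict: "\<exists>N\<in>?SS. restricts_to M N" if M: "M \<in> ?SH" for M
  proof -
    obtain N :: "(('k, 'v) sym, 'u) module" where "left_module (sym_algebra sV) N" "restricts_to M N"
      using restriction_exists[OF HM[OF M] killed[OF M] kap] by blast
    with simple_restricts_iff[OF HM[OF M] _ _ killed[OF M], of N] M show ?thesis by blast
  qed
  have inflate: "\<exists>M\<in>?SH. restricts_to M N \<and> killed_by \<mm> M" if N: "N \<in> ?SS" for N
  proof -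
    obtain M :: "(('k, 'v, 'a) smash, 'u) module"
      where "left_module smash_algebra M" "restricts_to M N" "killed_by \<mm> M"
      using inflation_exists[OF SN[OF N] lam kap] by blast
    with simple_restricts_iff[of M N] N SN[OF N] show ?thesis by blast
  qed
  have "\<exists>\<Phi>. bij_betw \<Phi> (?SH // ?iH) (?SS // ?iS) \<and>
    (\<forall>M\<in>?SH. \<forall>N\<in>?SS. restricts_to M N \<longrightarrow> \<Phi> (?iH `` {M}) = ?iS `` {N})"
  proof (rule quotient_bijection_of_relation[OF equiv_simple_iso_rel equiv_simple_iso_rel])
    show "\<exists>N\<in>?SS. restricts_to M N" if "M \<in> ?SH" for M using restrict[OF that] .
    show "\<exists>M\<in>?SH. restricts_to M N" if "N \<in> ?SS" for N using inflate[OF that] by blast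
    show "(M, M') \<in> ?iH \<longleftrightarrow> (N, N') \<in> ?iS"
      if "M \<in> ?SH" "M' \<in> ?SH" "N \<in> ?SS" "N' \<in> ?SS" "restricts_to M N" "restricts_to M' N'" for M M' N N'
      using module_iso_restricts_iff[OF HM HM SN SN that(5,6) killed killed] that
      by (simp add: simple_iso_rel_def)
  qed
  then obtain \<Phi> where bij: "bij_betw \<Phi> (?SH // ?iH) (?SS // ?iS)"
    and \<Phi>: "\<And>M N. \<lbrakk>M \<in> ?SH; N \<in> ?SS; restricts_to M N\<rbrakk> \<Longrightarrow> \<Phi> (?iH `` {M}) = ?iS `` {N}"
    by blast
  have inv: "inv_into (?SH // ?iH) \<Phi> (?iS `` {N}) = ?iH `` {M}"
    if "M \<in> ?SH" "N \<in> ?SS" "restricts_to M N" for M N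
    using \<Phi>[OF that] inv_into_f_f[OF bij_betw_imp_inj_on[OF bij] quotientI[OF that(1)]] by simp
  have "restriction_bijection \<mm> \<Phi>"
    unfolding restriction_bijection_def Let_def
  proof (intro conjI ballI)
    show "bij_betw \<Phi> (?SH // ?iH) (?SS // ?iS)" by (rule bij)
    show "\<exists>N\<in>?SS. restricts_to M N \<and> \<Phi> (?iH `` {M}) = ?iS `` {N}" if M: "M \<in> ?SH" for M
      using restrict[OF M] \<Phi>[OF M] by blast
    show "\<exists>M\<in>?SH. restricts_to M N \<and> killed_by \<mm> M \<and> inv_into (?SH // ?iH) \<Phi> (?iS `` {N}) = ?iH `` {M}"
      if N: "N \<in> ?SS" for N
      using inflate[OF N] inv[OF _ N] by blast
  qed
  then show ?thesis by blast
qed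

text \<open>
  An element of \<open>A\<close> that acts as zero on a nonzero module killed by \<open>\<mm>\<close> lies in \<open>\<mm>\<close>, because it acts by
  its augmentation.  The elements \<open>\<lambda>(a, v)\<close> and \<open>\<kappa>\<^sub>A(v, w)\<close> act as zero: all operators on a
  one-dimensional module commute, so the remaining terms of the two relations cancel.
\<close>

lemma one_dimensional_killed_imp:
  fixes M :: "(('k, 'v, 'a) smash, 'u) module"
  assumes M: "left_module smash_algebra M" and dim: "one_dimensional smash_scalar M"
    and kill: "killed_by \<mm> M" and kap: "\<And>v w. fst (kap v w) = 0"
  shows "lam a v \<in> \<mm>" and "snd (kap v w) \<in> \<mm>"
proof -
  interpret M: left_module smash_algebra M by fact
  interpret L: linear_operators M sW "\<lambda>c x. smash_scalar c \<odot>\<^bsub>M\<^esub> x" "\<lambda>p x. H.gen p \<odot>\<^bsub>M\<^esub> x"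
    by (rule smash_module_linear) fact
  obtain x where x: "x \<in> carrier M" "x \<noteq> \<zero>\<^bsub>M\<^esub>" "carrier M = {smash_scalar c \<odot>\<^bsub>M\<^esub> x | c. True}"
    using dim by (auto simp: one_dimensional_def)
  have A: "smash_A b \<odot>\<^bsub>M\<^esub> y = smash_scalar (aug b) \<odot>\<^bsub>M\<^esub> y" if "y \<in> carrier M" for b y
    using killed_by_smash_A[OF M that] kill that by (simp add: killed_by_def)
  have m: "b \<in> \<mm>" if "smash_A b \<odot>\<^bsub>M\<^esub> x = \<zero>\<^bsub>M\<^esub>" for b
  proof (rule ccontr)
    assume "b \<notin> \<mm>"
    then have "x = smash_scalar (inverse (aug b) * aug b) \<odot>\<^bsub>M\<^esub> x"
      using x(1) by (simp add: aug_m L.scal_one)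
    also have "\<dots> = smash_scalar (inverse (aug b)) \<odot>\<^bsub>M\<^esub> (smash_scalar (aug b) \<odot>\<^bsub>M\<^esub> x)"
      by (rule L.scal_mult[OF x(1)])
    also have "\<dots> = \<zero>\<^bsub>M\<^esub>"
      using that x(1) by (simp add: A M.smult_r_null smash_closed)
    finally show False using x(2) by simp
  qed
  have V: "smash_V v \<odot>\<^bsub>M\<^esub> y \<in> carrier M" if "y \<in> carrier M" for v y
    using that by (simp add: M.smult_closed smash_closed)
  show "lam a v \<in> \<mm>"
  proof (rule m)
    obtain qs where qs: "set qs \<subseteq> \<mm> \<times> \<mm>" "\<Delta> a = tensor2 sA (qs @ [(sA (aug a) 1, 1)])"
      by (rule cop_presentation)
    have act: "act (sA (aug a) 1) v = sV (aug a) v"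
      by (simp add: bilinear_mapD[OF act_bilinear] act_one)
    have "smash_V (sV (aug a) v) \<odot>\<^bsub>M\<^esub> x = smash_scalar (aug a) \<odot>\<^bsub>M\<^esub> (smash_V v \<odot>\<^bsub>M\<^esub> x)"
      using L.opr_scale[OF x(1), of "aug a" "(v, 0)"] by (simp add: smash_eqs(2) scale_prod_def)
    \<comment> \<open>the factors in \<open>\<mm>\<close> act as zero, so only the last summand of the presentation contributes\<close>
    moreover from qs(1) have "list_sum M (map (\<lambda>(y, z). smash_V (act y v) \<odot>\<^bsub>M\<^esub> (smash_A z \<odot>\<^bsub>M\<^esub> x)) (qs @ [(sA (aug a) 1, 1)]))
        = smash_V (sV (aug a) v) \<odot>\<^bsub>M\<^esub> x"
    proof (induction qs)
      case Nil
      show ?case using x(1) by (simp add: list_sum_def act smash_module_relations(2)[OF M] V)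
    next
      case (Cons p qs)
      then have "smash_A (snd p) \<odot>\<^bsub>M\<^esub> x = \<zero>\<^bsub>M\<^esub>" using kill x(1) by (auto simp: killed_by_def)
      then show ?case
        using Cons x(1) by (simp add: list_sum_def case_prod_beta M.smult_r_null smash_closed V)
    qed
    ultimately have "smash_scalar (aug a) \<odot>\<^bsub>M\<^esub> (smash_V v \<odot>\<^bsub>M\<^esub> x) =
        smash_scalar (aug a) \<odot>\<^bsub>M\<^esub> (smash_V v \<odot>\<^bsub>M\<^esub> x) \<oplus>\<^bsub>M\<^esub> smash_A (lam a v) \<odot>\<^bsub>M\<^esub> x"
      using smash_module_relations(3)[OF M x(1) qs(2), of v] A[OF V[OF x(1)], of a v] by argo
    then show "smash_A (lam a v) \<odot>\<^bsub>M\<^esub> x = \<zero>\<^bsub>M\<^esub>"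
      using x(1) M.M.add.l_cancel_one' V by (simp add: L.scal_closed M.smult_closed smash_closed)
  qed
  show "snd (kap v w) \<in> \<mm>"
  proof (rule m)
    obtain c d where cd: "smash_V v \<odot>\<^bsub>M\<^esub> x = smash_scalar c \<odot>\<^bsub>M\<^esub> x" "smash_V w \<odot>\<^bsub>M\<^esub> x = smash_scalar d \<odot>\<^bsub>M\<^esub> x"
      using V[OF x(1), of v] V[OF x(1), of w] unfolding x(3) by blast
    have "smash_V u \<odot>\<^bsub>M\<^esub> (smash_scalar e \<odot>\<^bsub>M\<^esub> x) = smash_scalar e \<odot>\<^bsub>M\<^esub> (smash_V u \<odot>\<^bsub>M\<^esub> x)" for u e
      using L.opr_scal[OF x(1), of "(u, 0)" e] by (simp add: smash_eqs(2))
    then have comm: "smash_V v \<odot>\<^bsub>M\<^esub> (smash_V w \<odot>\<^bsub>M\<^esub> x) = smash_V w \<odot>\<^bsub>M\<^esub> (smash_V v \<odot>\<^bsub>M\<^esub> x)"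
      using L.scal_mult[OF x(1), of c d] L.scal_mult[OF x(1), of d c] by (simp add: cd mult.commute)
    have "smash_V 0 \<odot>\<^bsub>M\<^esub> x = \<zero>\<^bsub>M\<^esub>"
      using L.opr_scale[OF x(1), of 0 "(0, 0)"] L.scal_zero[OF V[OF x(1)], of 0]
      by (simp add: smash_eqs(2) scale_prod_def)
    then show "smash_A (snd (kap v w)) \<odot>\<^bsub>M\<^esub> x = \<zero>\<^bsub>M\<^esub>"
      using smash_module_relations(4)[OF M x(1), of v w] comm x(1) V M.M.add.l_cancel_one'
      by (simp add: kap L.scal_closed M.smult_closed smash_closed)
  qed
qed

text \<open>
  The field itself with \<open>V\<close> acting as zero, transported along \<open>g\<close> into the type of the carriers.
\<close>

lemma trivial_simple_sym_module:
  fixes g :: "'k \<Rightarrow> 'u"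
  assumes g: "inj g"
  obtains N :: "(('k, 'v) sym, 'u) module"
  where "N \<in> simple_modules (sym_algebra sV)" "one_dimensional (sym_scalar sV) N"
proof -
  define h where "h = inv_into UNIV g"
  have h [simp]: "h (g c) = c" for c using g by (simp add: h_def)
  define M :: "'u ring" where "M = \<lparr>carrier = range g, monoid.mult = undefined, one = undefined,
    ring.zero = g 0, ring.add = (\<lambda>x y. g (h x + h y))\<rparr>"
  have M [simp]: "carrier M = range g" "\<zero>\<^bsub>M\<^esub> = g 0" "x \<oplus>\<^bsub>M\<^esub> y = g (h x + h y)" for x y
    by (simp_all add: M_def)
  have "abelian_group M"
  proof (rule abelian_groupI)
    show "\<exists>y\<in>carrier M. y \<oplus>\<^bsub>M\<^esub> x = \<zero>\<^bsub>M\<^esub>" for x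
      by (rule bexI[of _ "g (- h x)"]) auto
  qed (auto simp: algebra_simps)
  then have op: "linear_operators M sV (\<lambda>c x. g (c * h x)) (\<lambda>v x. g 0)"
    by (intro linear_operators.intro linear_operators_axioms.intro V.vector_space_axioms)
      (auto simp: algebra_simps)
  interpret L: linear_operators M sV "\<lambda>c x. g (c * h x)" "\<lambda>v x. g 0" by (rule op)
  show ?thesis
  proof (rule S.module_of_linear_operators[OF op])
    fix r x assume "r \<in> sym_relations sV" "x \<in> carrier M"
    then show "r \<odot>\<^bsub>L.tensor_module\<^esub> x = \<zero>\<^bsub>M\<^esub>"
      using sym_relations_annihilate_iff[OF L.left_module_tensor, of x] by (simp add: L.tvec_smult)
  next
    fix N :: "(('k, 'v) sym, 'u) module"
    assume N: "left_module S.Q N" "carrier N = carrier M" "\<zero>\<^bsub>N\<^esub> = \<zero>\<^bsub>M\<^esub>"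
      and scl: "\<And>c x. x \<in> carrier M \<Longrightarrow> S.scl c \<odot>\<^bsub>N\<^esub> x = g (c * h x)"
    have g_eq: "g c = g d \<longleftrightarrow> c = d" for c d using g by (auto dest: injD)
    have "one_dimensional (sym_scalar sV) N"
      unfolding one_dimensional_def
      by (rule bexI[of _ "g 1"]) (auto simp: N scl sym_eqs g_eq)
    moreover have "K = {\<zero>\<^bsub>N\<^esub>} \<or> K = carrier N" if K: "submodule K S.Q N" for K
    proof (rule disjCI)
      note K' = submodule_facts[OF K]
      assume ne: "K \<noteq> carrier N"
      have "c = 0" if c: "g c \<in> K" for c
      proof (rule ccontr)
        assume "c \<noteq> 0"
        have "g d \<in> K" for d
          using K'(4)[OF S.scl_closed c, of "d / c"] \<open>c \<noteq> 0\<close> by (simp add: scl)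
        with ne K'(1) show False by (auto simp: N)
      qed
      then show "K = {\<zero>\<^bsub>N\<^esub>}" using K'(1,2) by (auto simp: N)
    qed
    moreover have "carrier N \<noteq> {\<zero>\<^bsub>N\<^esub>}"
    proof
      assume "carrier N = {\<zero>\<^bsub>N\<^esub>}"
      then have "g 1 = g 0" by (auto simp: N)
      then show False by (simp add: g_eq)
    qed
    ultimately have "N \<in> simple_modules (sym_algebra sV)" "one_dimensional (sym_scalar sV) N"
      using N(1) by (auto simp: simple_modules_def sym_eqs)
    then show ?thesis by (rule that)
  qed
qed

text \<open>
  The inflation of the trivial simple module is one-dimensional and killed by \<open>\<mm>\<close>.
\<close>

lemma restriction_bijection_imp_one_dimensional:
  fixes \<Phi> :: "(('k, 'v, 'a) smash, 'u) module set \<Rightarrow> (('k, 'v) sym, 'u) module set"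
  assumes \<Phi>: "restriction_bijection \<mm> \<Phi>" and g: "inj (g :: 'k \<Rightarrow> 'u)"
  shows "\<exists>M :: (('k, 'v, 'a) smash, 'u) module.
    left_module smash_algebra M \<and> one_dimensional smash_scalar M \<and> killed_by \<mm> M"
proof -
  obtain N :: "(('k, 'v) sym, 'u) module"
    where N: "N \<in> simple_modules (sym_algebra sV)" "one_dimensional (sym_scalar sV) N"
    by (rule trivial_simple_sym_module[OF g])
  obtain M :: "(('k, 'v, 'a) smash, 'u) module"
    where M: "M \<in> simple_modules smash_algebra" "restricts_to M N" "killed_by \<mm> M"
    using \<Phi> N(1) unfolding restriction_bijection_def Let_def by blast
  have mods: "left_module smash_algebra M" "left_module (sym_algebra sV) N"
    using M(1) N(1) by (simp_all add: simple_modules_def)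
  obtain x where x: "x \<in> carrier N" "x \<noteq> \<zero>\<^bsub>N\<^esub>" "carrier N = {sym_scalar sV c \<odot>\<^bsub>N\<^esub> x | c. True}"
    using N(2) unfolding one_dimensional_def by blast
  have xM: "x \<in> carrier M" using x(1) restricts_toD(1)[OF M(2)] by simp
  have "carrier M = {smash_scalar c \<odot>\<^bsub>M\<^esub> x | c. True}"
    using x(3) unfolding restricts_toD(1)[OF M(2)] restricts_toD(3)[OF M(2) xM] .
  then have "one_dimensional smash_scalar M"
    unfolding one_dimensional_def using xM x(2) restricts_to_zero[OF mods M(2)] by auto
  then show ?thesis using mods(1) M(3) by blast
qed

end

section \<open>The characterization\<close>

theorem theorem6p3:
  fixes sA :: "'k::field \<Rightarrow> 'a::ring_1 \<Rightarrow> 'a"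
    and \<Delta> :: "'a \<Rightarrow> ('k, 'a) tensor"
    and \<mm> :: "'a set"
    and sV :: "'k \<Rightarrow> 'v::ab_group_add \<Rightarrow> 'v"
    and act :: "'a \<Rightarrow> 'v \<Rightarrow> 'v"
    and lam :: "'a \<Rightarrow> 'v \<Rightarrow> 'a"
    and kap :: "'v \<Rightarrow> 'v \<Rightarrow> 'v \<times> 'a"
  assumes A: "cocommutative_algebra sA \<Delta>"
    and m_maximal: "maximalideal \<mm> ring_of_type_algebra"
    and m_nilpotent: "\<exists>n. ideal_power \<mm> n = {0}"
    and m_nonzero: "\<mm> \<noteq> {0}"
    and A_decomp: "\<forall>a. \<exists>!p. fst p \<in> \<mm> \<and> a = fst p + sA (snd p) 1"
    and cop_m: "\<forall>a\<in>\<mm>. \<exists>ps. set ps \<subseteq> \<mm> \<times> \<mm> \<and> \<Delta> a = tensor2 sA ps"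
    and V: "algebra_module sA sV act"
    and lam_bilinear: "bilinear_map sA sV sA lam"
    and kap_bilinear: "bilinear_map sV sV (scale_prod sV sA) kap"
    and kap_alternating: "\<forall>v. kap v v = 0"
    and universe: "\<exists>f :: (('v \<times> 'a) list \<Rightarrow>\<^sub>0 'k) \<Rightarrow> 'u. inj f"
  defines "lam_condition \<equiv>
      (\<forall>a a' v ps. \<Delta> a' = tensor2 sA ps \<longrightarrow>
         lam (a * a') v = a * lam a' v + (\<Sum>(x, y)\<leftarrow>ps. lam a (act x v) * y))"
    and "c1 \<equiv> (\<forall>k. \<forall>a\<in>ideal_power \<mm> k. \<forall>v. lam a v \<in> ideal_power \<mm> k)
      \<and> (\<forall>v v'. snd (kap v v') \<in> \<mm>)"
    and "c2 \<equiv> (\<forall>a\<in>\<mm>. \<forall>v. lam a v \<in> \<mm>) \<and> (\<forall>v v'. snd (kap v v') \<in> \<mm>)"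
    and "c3 \<equiv> (\<exists>M :: (('k, 'v, 'a) smash, 'u) module.
      left_module (smash_data.smash_algebra sA \<Delta> sV act lam kap) M
      \<and> one_dimensional (smash_data.smash_scalar sA \<Delta> sV act lam kap) M
      \<and> smash_data.killed_by sA \<Delta> sV act lam kap \<mm> M)"
    and "c4 \<equiv> (\<exists>\<Phi> :: (('k, 'v, 'a) smash, 'u) module set \<Rightarrow> (('k, 'v) sym, 'u) module set.
      smash_data.restriction_bijection sA \<Delta> sV act lam kap \<mm> \<Phi>)"
  shows "(lam_condition \<longrightarrow>
      (\<forall>k. \<forall>a\<in>ideal_power \<mm> k. \<forall>v\<in>level_le act \<mm> k. lam a v \<in> ideal_power \<mm> k))
    \<and> ((\<forall>v v'. fst (kap v v') = 0) \<and> lam_condition \<longrightarrow>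
      (c1 \<longleftrightarrow> c2) \<and> (c2 \<longleftrightarrow> c3) \<and> (c3 \<longleftrightarrow> c4))
    \<and> ((\<forall>v v'. fst (kap v v') = 0) \<longrightarrow>
      (c1 \<longrightarrow> c2) \<and> (c3 \<longrightarrow> c2) \<and> (c3 \<longleftrightarrow> c4) \<and> ((\<forall>v. lam 1 v \<in> \<mm>) \<longrightarrow> c2 \<longrightarrow> c3))"
proof -
  interpret deformation_data sA \<Delta> \<mm> sV act lam kap
  proof (intro deformation_data.intro nilpotent_augmentation.intro nilpotent_augmentation_axioms.intro
      deformation_data_axioms.intro A V)
    show "ideal \<mm> ring_of_type_algebra" using m_maximal by (rule maximalideal.axioms)
  qed (use m_nilpotent A_decomp cop_m lam_bilinear in auto)
  obtain f :: "(('v \<times> 'a) list \<Rightarrow>\<^sub>0 'k) \<Rightarrow> 'u" where f: "inj f" using universe by blast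
  have g: "inj (\<lambda>c. f (Poly_Mapping.single [] c))"
    using inj_compose[OF f inj_single[of "[]"]] by (simp add: comp_def)
  have twist: "lam_condition \<longleftrightarrow> twisted_derivation"
    unfolding lam_condition_def twisted_derivation_def ..
  have c12: "c1 \<longrightarrow> c2"
    unfolding c1_def c2_def using ideal_power_1 by metis
  have c21: "lam_condition \<Longrightarrow> c2 \<Longrightarrow> c1"
    unfolding c1_def c2_def twist using lam_preserves_powers by blast
  have c43: "c4 \<Longrightarrow> c3"
    unfolding c3_def c4_def using restriction_bijection_imp_one_dimensional[OF _ g] by blast
  have c3D: "(\<forall>a v. lam a v \<in> \<mm>) \<and> (\<forall>v w. snd (kap v w) \<in> \<mm>)" if "\<forall>v v'. fst (kap v v') = 0" c3
    using that one_dimensional_killed_imp unfolding c3_def by blast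
  have c4I: "c4" if "\<forall>a v. lam a v \<in> \<mm>" "\<forall>v v'. fst (kap v v') = 0" "\<forall>v w. snd (kap v w) \<in> \<mm>"
    unfolding c4_def using restriction_bijection_exists that by blast
  have lam_all: "lam a v \<in> \<mm>" if c2 and one: "\<forall>v. lam 1 v \<in> \<mm>" for a v
  proof -
    obtain x where x: "x \<in> \<mm>" "a = x + sA (aug a) 1" by (rule aug_cases)
    have "lam (x + sA (aug a) 1) v \<in> \<mm>"
      using that x(1) unfolding c2_def
      by (simp add: bilinear_mapD[OF lam_bilinear] m_closed(2) m_scale)
    then show ?thesis using x(2) by simp
  qed
  have c24: "c4" if "\<forall>v v'. fst (kap v v') = 0" "\<forall>v. lam 1 v \<in> \<mm>" c2
    using c4I lam_all that unfolding c2_def by blast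
  have one: "\<forall>v. lam 1 v \<in> \<mm>" if lam_condition
    using lam_one that m_closed(1) by (simp add: twist)
  have part1: "lam_condition \<longrightarrow>
      (\<forall>k. \<forall>a\<in>ideal_power \<mm> k. \<forall>v\<in>level_le act \<mm> k. lam a v \<in> ideal_power \<mm> k)"
    unfolding twist using lam_preserves_powers by blast
  have c32: "c3 \<Longrightarrow> c2" if "\<forall>v v'. fst (kap v v') = 0"
    using c3D[OF that] unfolding c2_def by blast
  have c34: "c3 \<Longrightarrow> c4" if "\<forall>v v'. fst (kap v v') = 0"
    using c3D[OF that] c4I that by blast
  show ?thesis
    using part1 c12 c21 c43 c32 c34 c24 one by blast
qed

end
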